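(* Let $K\subset\mathbb{R}^n$ be a nonempty closed semi-algebraic set and let $f_1,\dots,f_m:\mathbb{R}^n\to\mathbb{R}$ be polynomial functions. Then both the weak Pareto solution set $\mathrm{Sol}^w(\mathrm{PVP})$ and the Pareto solution set $\mathrm{Sol}(\mathrm{PVP})$ of the polynomial vector optimization problem of minimizing $f=(f_1,\dots,f_m)$ over $K$ are semi-algebraic subsets of $\mathbb{R}^n$. Consequently, each of them has finitely many connected components and every connected component is path connected.
   Context: A set in $\mathbb{R}^n$ is semi-algebraic if it is a finite union of sets of the form $\{x\in\mathbb{R}^n: h_1(x)=\dots=h_\ell(x)=0,\ g_{\ell+1}(x)<0,\dots,g_p(x)<0\}$ with all $h_i,g_j$ in $\mathbb{R}[x_1,\dots,x_n]$. A point $x\in K$ is a Pareto solution if $f(y)-f(x)\notin -\mathbb{R}^m_+\setminus\{0\}$ for all $y\in K$, and a weak Pareto solution if $f(y)-f(x)\notin -\mathrm{int}\,\mathbb{R}^m_+$ for all $y\in K$; here $\mathbb{R}^m_+$ is the nonnegative orthant, $\mathrm{int}\,\mathbb{R}^m_+$ is its interior, and $-\mathbb{R}^m_+\setminus\{0\}$ means $(-\mathbb{R}^m_+)\setminus\{0\}$. $\mathrm{Sol}(\mathrm{PVP})$ and $\mathrm{Sol}^w(\mathrm{PVP})$ denote the sets of all Pareto solutions and of all weak Pareto solutions, respectively. Connected components and path connectedness are with respect to the topology induced from $\mathbb{R}^n$. *)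

theory Defs
  imports "HOL-Analysis.Analysis"
begin

text \<open>The predicate \<^const>\<open>real_polynomial_function\<close> on \<^typ>\<open>real ^ 'n\<close> is closed under
  constants, (bounded) linear forms, sums and products, so it describes exactly the functions
  given by polynomials in the coordinates. In the next definition \<open>H\<close> collects the equations and
  \<open>G\<close> the strict inequalities; either family may be empty.\<close>

definition basic_semialgebraic :: "(real ^ 'n) set \<Rightarrow> bool" where
  "basic_semialgebraic B \<longleftrightarrow>
     (\<exists>H G. finite H \<and> finite G \<and>
        (\<forall>h\<in>H. real_polynomial_function h) \<and> (\<forall>g\<in>G. real_polynomial_function g) \<and>
        B = {x. (\<forall>h\<in>H. h x = 0) \<and> (\<forall>g\<in>G. g x < 0)})"

definition semialgebraic :: "(real ^ 'n) set \<Rightarrow> bool" where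
  "semialgebraic S \<longleftrightarrow> (\<exists>\<B>. finite \<B> \<and> (\<forall>B\<in>\<B>. basic_semialgebraic B) \<and> S = \<Union>\<B>)"

definition nonneg_orthant :: "(real ^ 'm) set" where
  "nonneg_orthant = {v. \<forall>i. 0 \<le> v $ i}"

definition pareto_solutions :: "(real ^ 'n) set \<Rightarrow> (real ^ 'n \<Rightarrow> real ^ 'm) \<Rightarrow> (real ^ 'n) set" where
  "pareto_solutions K f = {x \<in> K. \<forall>y\<in>K. f y - f x \<notin> uminus ` nonneg_orthant - {0}}"

definition weak_pareto_solutions :: "(real ^ 'n) set \<Rightarrow> (real ^ 'n \<Rightarrow> real ^ 'm) \<Rightarrow> (real ^ 'n) set" where
  "weak_pareto_solutions K f = {x \<in> K. \<forall>y\<in>K. f y - f x \<notin> uminus ` interior nonneg_orthant}"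

end

theory Submission
  imports Defs "HOL-Library.Multiset"
begin

text \<open>
  Both conclusions come from one fact about real polynomials in \<open>n + 1\<close> variables: read as
  polynomials in the last variable, finitely many of them have only finitely many patterns of
  signs along the fibres over \<open>\<real>\<^sup>n\<close>, and which pattern occurs is decided by the signs of finitely
  many polynomials in the first \<open>n\<close> variables (\<open>fibre_sign_iso_exists\<close>). That two fibres have the same
  pattern is expressed by an increasing bijection of the real line that carries the signs on one
  fibre to the signs on the other. The proof is the elimination procedure of Cohen and
  Hoermander: the signs of a polynomial \<open>p\<close> are recovered from those of its derivative, of the other
  polynomials, and of the remainders of \<open>p\<close> modulo all of these, because at a root of \<open>q\<close> the sign
  of \<open>p\<close> is that of its remainder modulo \<open>q\<close>, and between two neighbouring roots of the others
  \<open>p\<close> is monotone (\<open>sign_iso_insert\<close>).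

  A set is semialgebraic exactly if membership is decided by the signs of finitely many polynomials
  (\<open>semialgebraic_iff_sign_determined\<close>). In this form Boolean combinations are immediate, and so is the
  Tarski-Seidenberg theorem (\<open>sign_determined_projection\<close>). The two solution sets consist of the
  points of \<open>K\<close> that no point of \<open>K\<close> improves, where improvement depends only on the signs of the
  coordinates of \<open>f y - f x\<close>; hence each is \<open>K\<close> minus a projection (\<open>semialgebraic_unimprovable_points\<close>).

  For the components, a family closed under differentiation is used. Over a set on which the
  sign pattern is constant the number of roots in the fibre is constant, and each root survives a
  small perturbation since some derivative changes sign there; so the ordered roots are continuous
  functions (\<open>continuous_on_nth_fibre_root\<close>). Their graphs and the bands between them give, by
  induction on the dimension, a finite decomposition of the space into path-connected cells with
  constant signs (\<open>cylindrical_decomposition\<close>). Each cell has a continuous section over the cell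
  below it, and therefore, if its points have arbitrarily small positive first coordinates, a curve
  parametrised by these. Applied to the set of all
  \<open>(t, y)\<close> with \<open>y \<in> S\<close> and \<open>\<bar>y - a\<bar> < t\<close>, this yields a curve inside \<open>S\<close> that ends at a given limit
  point \<open>a\<close>. So the path components of a semialgebraic set, which are finitely many, are
  relatively closed, and a connected component cannot contain more than one of them
  (\<open>semialgebraic_components\<close>).
\<close>

section \<open>Matching the signs of univariate polynomials\<close>

abbreviation order_iso :: "(real \<Rightarrow> real) \<Rightarrow> bool" where
  "order_iso \<phi> \<equiv> strict_mono \<phi> \<and> surj \<phi>"

text \<open>By induction from left to right: to the right of the largest point treated so far the map is
  continued by the affine function through the next prescribed value.\<close>

lemma order_iso_extends_finite:
  fixes f :: "real \<Rightarrow> real"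
  assumes "finite W" and "strict_mono_on W f"
  shows "\<exists>\<psi>. order_iso \<psi> \<and> (\<forall>w\<in>W. \<psi> w = f w)"
  using assms
proof (induction W rule: finite_linorder_max_induct)
  case empty
  have "order_iso id"
    by (simp add: strict_mono_def)
  then show ?case by auto
next
  case (insert b A)
  have "strict_mono_on A f"
    using insert.prems by (auto simp: strict_mono_on_def)
  then obtain \<psi> where \<psi>: "strict_mono \<psi>" "surj \<psi>" "\<forall>w\<in>A. \<psi> w = f w"
    using insert.IH by blast
  show ?case
  proof (cases "A = {}")
    case True
    have "order_iso (\<lambda>y. y + (f b - b))"
      by (auto simp: strict_mono_def intro!: surjI[where f="\<lambda>y. y - (f b - b)"])
    then show ?thesis using True by (intro exI[of _ "\<lambda>y. y + (f b - b)"]) auto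
  next
    case False
    define m where "m = Max A"
    have m: "m \<in> A" "\<And>w. w \<in> A \<Longrightarrow> w \<le> m" "m < b"
      using False insert.hyps by (auto simp: m_def)
    have "f m < f b"
      using insert.prems m by (auto simp: strict_mono_on_def)
    define k where "k = (f b - f m) / (b - m)"
    have k: "k > 0" "k * (b - m) = f b - f m"
      using \<open>f m < f b\<close> \<open>m < b\<close> by (auto simp: k_def)
    define g where "g y = (if y \<le> m then \<psi> y else f m + k * (y - m))" for y
    have gm: "\<psi> m = f m" using m \<psi> by auto
    have "strict_mono g"
    proof (rule strict_monoI)
      fix x y :: real assume xy: "x < y"
      consider "y \<le> m" | "x \<le> m" "m < y" | "m < x" by linarith
      then show "g x < g y"
      proof cases
        case 1 then show ?thesis using xy \<psi>(1) by (simp add: g_def strict_mono_def)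
      next
        case 2
        have "\<psi> x \<le> f m" using 2 \<psi>(1) gm by (metis strict_mono_less_eq)
        moreover have "k * (y - m) > 0" using 2 k by simp
        ultimately show ?thesis using 2 by (simp add: g_def)
      next
        case 3 then show ?thesis using xy k by (simp add: g_def)
      qed
    qed
    moreover have "\<exists>x. g x = y" for y
    proof (cases "y \<le> f m")
      case True
      obtain x where x: "\<psi> x = y" using \<psi>(2) by (metis surjD)
      then have "x \<le> m" using True gm \<psi>(1) by (metis strict_mono_less_eq)
      then show ?thesis using x by (auto simp: g_def)
    next
      case False
      have "g (m + (y - f m) / k) = y"
        using False k(1) divide_pos_pos[of "y - f m" k]
        by (auto simp: g_def not_le dest: leD)
      then show ?thesis by blast
    qed
    then have "surj g" by (metis surjI surj_def)
    moreover have "g w = f w" if "w \<in> insert b A" for w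
      using that m k \<psi>(3) by (auto simp: g_def)
    ultimately show ?thesis by blast
  qed
qed

lemma sgn_poly_eq_of_no_root:
  fixes p :: "real poly"
  assumes "\<And>t. min a b \<le> t \<Longrightarrow> t \<le> max a b \<Longrightarrow> poly p t \<noteq> 0"
  shows "sgn (poly p a) = sgn (poly p b)"
proof (rule ccontr)
  assume ne: "sgn (poly p a) \<noteq> sgn (poly p b)"
  have nz: "poly p a \<noteq> 0" "poly p b \<noteq> 0" using assms by auto
  have mul: "poly p a * poly p b < 0"
    using ne nz by (auto simp: sgn_if mult_less_0_iff split: if_splits)
  have "a \<noteq> b" using ne by auto
  then consider "a < b" | "b < a" by linarith
  then show False
  proof cases
    case 1 show ?thesis using poly_IVT[OF 1 mul] assms 1 by force
  next
    case 2 show ?thesis using poly_IVT[OF 2, of p] mul assms 2 by (force simp: mult.commute)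
  qed
qed

lemma poly_mono_of_sgn_pderiv:
  fixes p :: "real poly"
  assumes "a < b" and "s \<noteq> 0"
    and "\<And>t. a < t \<Longrightarrow> t < b \<Longrightarrow> sgn (poly (pderiv p) t) = s"
  shows "s * poly p a < s * poly p b"
proof -
  have "poly (smult s p) a < poly (smult s p) b"
  proof (rule DERIV_pos_imp_increasing_open[OF assms(1)])
    fix t assume t: "a < t" "t < b"
    have "s * poly (pderiv p) t > 0"
      using assms(3)[OF t] assms(2)
      by (auto simp: sgn_if zero_less_mult_iff split: if_splits)
    moreover have "DERIV (poly (smult s p)) t :> s * poly (pderiv p) t"
      using poly_DERIV[of "smult s p" t] unfolding pderiv_smult by (simp only: poly_smult[of s "pderiv p"])
    ultimately show "\<exists>y. DERIV (poly (smult s p)) t :> y \<and> 0 < y" by blast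
  qed (auto intro!: continuous_intros)
  then show ?thesis by simp
qed

lemma sgn_eq_mult_iff:
  fixes a b s :: real
  assumes "sgn a = sgn b"
  shows "s * a < 0 \<longleftrightarrow> s * b < 0" "0 < s * a \<longleftrightarrow> 0 < s * b"
  using assms by (metis sgn_less sgn_mult, metis sgn_greater sgn_mult)

text \<open>Between two neighbouring points of \<open>Z\<close> both polynomials are strictly monotone in the same direction,
  so each has at most one root there, and whether it has one is decided by the signs at the two end
  points, which agree. Matching these roots as well gives a monotone map on a finite set; any
  extension of it to an increasing bijection preserves the signs. The points \<open>lo\<close> and \<open>hi\<close> enclose
  all roots, so that unbounded intervals need no analysis of their own.\<close>

lemma sign_iso_of_critical_signs:
  fixes p p2 :: "real poly"
  assumes fin: "finite Z" and phi: "order_iso \<phi>"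
    and val: "\<And>z. z \<in> Z \<Longrightarrow> sgn (poly p2 (\<phi> z)) = sgn (poly p z)"
    and der0: "\<And>y. y \<notin> Z \<Longrightarrow> poly (pderiv p) y \<noteq> 0"
    and der: "\<And>y. y \<notin> Z \<Longrightarrow> sgn (poly (pderiv p2) (\<phi> y)) = sgn (poly (pderiv p) y)"
    and lo: "lo \<in> Z" "\<And>y. y \<le> lo \<Longrightarrow> poly p y \<noteq> 0" "\<And>y. y \<le> \<phi> lo \<Longrightarrow> poly p2 y \<noteq> 0"
    and hi: "hi \<in> Z" "\<And>y. hi \<le> y \<Longrightarrow> poly p y \<noteq> 0" "\<And>y. \<phi> hi \<le> y \<Longrightarrow> poly p2 y \<noteq> 0"
  shows "\<exists>\<psi>. order_iso \<psi> \<and> (\<forall>z\<in>Z. \<psi> z = \<phi> z) \<and>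
             (\<forall>y. sgn (poly p2 (\<psi> y)) = sgn (poly p y))"
proof -
  have less_iff: "\<phi> a < \<phi> b \<longleftrightarrow> a < b" for a b
    using phi strict_mono_less by blast
  define gap where "gap z0 z1 \<longleftrightarrow> z0 \<in> Z \<and> z1 \<in> Z \<and> z0 < z1 \<and> (\<forall>t. z0 < t \<and> t < z1 \<longrightarrow> t \<notin> Z)" for z0 z1
  have gap_ex: "\<exists>z0 z1. gap z0 z1 \<and> z0 < y \<and> y < z1" if y: "y \<notin> Z" "lo < y" "y < hi" for y
  proof -
    define z0 where "z0 = Max {z\<in>Z. z < y}"
    define z1 where "z1 = Min {z\<in>Z. y < z}"
    have "z0 \<in> {z\<in>Z. z < y}" unfolding z0_def using fin lo(1) y by (intro Max_in) auto
    then have 0: "z0 \<in> Z" "z0 < y" by auto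
    have "z1 \<in> {z\<in>Z. y < z}" unfolding z1_def using fin hi(1) y by (intro Min_in) auto
    then have 1: "z1 \<in> Z" "y < z1" by auto
    have "t \<notin> Z" if t: "z0 < t" "t < z1" for t
    proof
      assume "t \<in> Z"
      then have "t < y \<Longrightarrow> t \<le> z0" "y < t \<Longrightarrow> z1 \<le> t"
        unfolding z0_def z1_def using fin by (auto intro: Max_ge Min_le)
      then show False using t y(1) \<open>t \<in> Z\<close> by (cases t y rule: linorder_cases) auto
    qed
    moreover have "z0 < z1" using 0 1 by linarith
    ultimately show ?thesis using 0 1 unfolding gap_def by blast
  qed
  have gap_mono: "\<exists>s. s \<noteq> 0 \<and>
      (\<forall>a b. z0 \<le> a \<longrightarrow> a < b \<longrightarrow> b \<le> z1 \<longrightarrow> s * poly p a < s * poly p b) \<and>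
      (\<forall>a b. \<phi> z0 \<le> a \<longrightarrow> a < b \<longrightarrow> b \<le> \<phi> z1 \<longrightarrow> s * poly p2 a < s * poly p2 b)"
    if g: "gap z0 z1" for z0 z1
  proof -
    define s where "s = sgn (poly (pderiv p) ((z0 + z1) / 2))"
    have nz: "t \<notin> Z" if "z0 < t" "t < z1" for t using g that by (auto simp: gap_def)
    have s0: "s \<noteq> 0"
      using nz[of "(z0 + z1) / 2"] der0 g by (auto simp: s_def sgn_eq_0_iff gap_def)
    have s1: "sgn (poly (pderiv p) t) = s" if "z0 < t" "t < z1" for t
      unfolding s_def by (rule sgn_poly_eq_of_no_root, rule der0, rule nz)
        (use that in \<open>auto simp: min_def max_def split: if_splits\<close>)
    have s2: "sgn (poly (pderiv p2) t) = s" if t: "\<phi> z0 < t" "t < \<phi> z1" for t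
    proof -
      obtain y where y: "t = \<phi> y" using phi by (metis surjD)
      then have "z0 < y" "y < z1" using t less_iff by auto
      then show ?thesis using der[of y] nz s1 y by simp
    qed
    show ?thesis
      using s0 poly_mono_of_sgn_pderiv[of _ _ s p] poly_mono_of_sgn_pderiv[of _ _ s p2] s1 s2
      by (intro exI[of _ s]) auto
  qed
  \<comment> \<open>\<open>corr w u\<close>: the root \<open>u\<close> of \<open>p2\<close> lies in the gap between points of \<open>\<phi> ` Z\<close> that corresponds
    to the gap of \<open>Z\<close> around \<open>w\<close>.\<close>
  define corr where "corr w u \<longleftrightarrow> poly p2 u = 0 \<and> (\<forall>z\<in>Z. z < w \<longrightarrow> \<phi> z < u) \<and> (\<forall>z\<in>Z. w < z \<longrightarrow> u < \<phi> z)" for w u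
  have corr_ex: "\<exists>u. corr w u" if w: "w \<notin> Z" "poly p w = 0" for w
  proof -
    have "lo < w" "w < hi" using lo(2)[of w] hi(2)[of w] w(2) by force+
    then obtain z0 z1 where z: "gap z0 z1" "z0 < w" "w < z1" using gap_ex w(1) by blast
    obtain s where s: "s \<noteq> 0"
      "\<And>a b. z0 \<le> a \<Longrightarrow> a < b \<Longrightarrow> b \<le> z1 \<Longrightarrow> s * poly p a < s * poly p b"
      using gap_mono[OF z(1)] by blast
    have zz: "z0 \<in> Z" "z1 \<in> Z" "z0 < z1" using z(1) by (auto simp: gap_def)
    have "s * poly p z0 < 0" "0 < s * poly p z1"
      using s(2)[of z0 w] s(2)[of w z1] z w(2) by auto
    then have "s * poly p2 (\<phi> z0) < 0" "0 < s * poly p2 (\<phi> z1)"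
      using sgn_eq_mult_iff[OF val[OF zz(1)], of s] sgn_eq_mult_iff[OF val[OF zz(2)], of s] by blast+
    then obtain u where u: "\<phi> z0 < u" "u < \<phi> z1" "poly p2 u = 0"
      using poly_IVT_pos[of "\<phi> z0" "\<phi> z1" "smult s p2"] less_iff zz s(1) by auto
    have "t \<le> z0" if "t \<in> Z" "t < w" for t
      using that z unfolding gap_def by (metis not_le order.strict_trans)
    moreover have "z1 \<le> t" if "t \<in> Z" "w < t" for t
      using that z unfolding gap_def by (metis not_le order.strict_trans)
    ultimately have "corr w u" unfolding corr_def using u less_iff by (meson le_less_trans less_le_trans not_le)
    then show ?thesis ..
  qed
  define f where "f w = (if w \<in> Z then \<phi> w else (SOME u. corr w u))" for w
  have f_corr: "corr w (f w)" if "w \<notin> Z" "poly p w = 0" for w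
    using corr_ex[OF that] that by (auto simp: f_def intro: someI_ex)
  define W where "W = Z \<union> {w. poly p w = 0}"
  have "p \<noteq> 0" using lo(2)[of lo] by auto
  then have finW: "finite W" using fin poly_roots_finite by (auto simp: W_def)
  have "f w1 < f w2" if w: "w1 \<in> W" "w2 \<in> W" "w1 < w2" for w1 w2
  proof (cases "w1 \<in> Z \<or> w2 \<in> Z")
    case True
    moreover have fZ: "f z = \<phi> z" if "z \<in> Z" for z using that by (simp add: f_def)
    moreover have "f z < f w" if "z \<in> Z" "z < w" "w \<in> W" for z w
      using that f_corr[of w] fZ less_iff by (cases "w \<in> Z") (auto simp: W_def corr_def)
    moreover have "f w < f z" if "z \<in> Z" "w < z" "w \<in> W" for z w
      using that f_corr[of w] fZ less_iff by (cases "w \<in> Z") (auto simp: W_def corr_def)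
    ultimately show ?thesis using w by blast
  next
    case False
    then have r: "poly p w1 = 0" "poly p w2 = 0" using w by (auto simp: W_def)
    have "lo < w1" "w1 < hi" using lo(2)[of w1] hi(2)[of w1] r(1) by force+
    then obtain z0 z1 where z: "gap z0 z1" "z0 < w1" "w1 < z1" using gap_ex False by blast
    have "z1 < w2"
    proof (rule ccontr)
      assume "\<not> z1 < w2"
      moreover obtain s where
        "\<And>a b. z0 \<le> a \<Longrightarrow> a < b \<Longrightarrow> b \<le> z1 \<Longrightarrow> s * poly p a < s * poly p b"
        using gap_mono[OF z(1)] by blast
      ultimately have "s * poly p w1 < s * poly p w2" using z(2) w(3) by simp
      then show False using r by simp
    qed
    moreover have "z1 \<in> Z" using z(1) by (auto simp: gap_def)
    ultimately show ?thesis
      using f_corr[of w1] f_corr[of w2] False r z unfolding corr_def by force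
  qed
  then obtain \<psi> where psi: "order_iso \<psi>" "\<And>w. w \<in> W \<Longrightarrow> \<psi> w = f w"
    using order_iso_extends_finite[OF finW, of f] by (auto simp: strict_mono_on_def)
  have psi_less: "\<psi> a < \<psi> b \<longleftrightarrow> a < b" for a b
    using psi(1) strict_mono_less by blast
  have psiZ: "\<psi> z = \<phi> z" if "z \<in> Z" for z using psi(2)[of z] that by (auto simp: W_def f_def)
  have "sgn (poly p2 (\<psi> y)) = sgn (poly p y)" for y
  proof -
    consider "y \<in> Z" | "y < lo" | "hi < y" | "y \<notin> Z" "lo < y" "y < hi"
      using lo(1) hi(1) by (cases "y \<in> Z"; cases "y < lo"; cases "hi < y"; cases "y = lo"; cases "y = hi") auto
    then show ?thesis
    proof cases
      case 1 then show ?thesis using psiZ val by simp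
    next
      case 2
      have a: "\<psi> y < \<phi> lo" using 2 psiZ[OF lo(1)] psi_less by metis
      have "sgn (poly p y) = sgn (poly p lo)"
        by (rule sgn_poly_eq_of_no_root, rule lo(2)) (use 2 in auto)
      moreover have "sgn (poly p2 (\<psi> y)) = sgn (poly p2 (\<phi> lo))"
        by (rule sgn_poly_eq_of_no_root, rule lo(3)) (use a in auto)
      ultimately show ?thesis using val[OF lo(1)] by simp
    next
      case 3
      have a: "\<psi> y > \<phi> hi" using 3 psiZ[OF hi(1)] psi_less by metis
      have "sgn (poly p y) = sgn (poly p hi)"
        by (rule sgn_poly_eq_of_no_root, rule hi(2)) (use 3 in auto)
      moreover have "sgn (poly p2 (\<psi> y)) = sgn (poly p2 (\<phi> hi))"
        by (rule sgn_poly_eq_of_no_root, rule hi(3)) (use a in auto)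
      ultimately show ?thesis using val[OF hi(1)] by simp
    next
      case 4
      then obtain z0 z1 where z: "gap z0 z1" "z0 < y" "y < z1" using gap_ex by blast
      have zz: "z0 \<in> Z" "z1 \<in> Z" "z0 < z1" using z(1) by (auto simp: gap_def)
      from gap_mono[OF z(1)] obtain s where "s \<noteq> 0"
        and "\<forall>a b. z0 \<le> a \<longrightarrow> a < b \<longrightarrow> b \<le> z1 \<longrightarrow> s * poly p a < s * poly p b"
        and "\<forall>a b. \<phi> z0 \<le> a \<longrightarrow> a < b \<longrightarrow> b \<le> \<phi> z1 \<longrightarrow> s * poly p2 a < s * poly p2 b"
        by (elim exE conjE) (rule that)
      then have s: "s \<noteq> 0"
        "\<And>a b. z0 \<le> a \<Longrightarrow> a < b \<Longrightarrow> b \<le> z1 \<Longrightarrow> s * poly p a < s * poly p b"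
        "\<And>a b. \<phi> z0 \<le> a \<Longrightarrow> a < b \<Longrightarrow> b \<le> \<phi> z1 \<Longrightarrow> s * poly p2 a < s * poly p2 b"
        by auto
      have py: "\<phi> z0 < \<psi> y" "\<psi> y < \<phi> z1" using z(2,3) psi_less[of z0 y] psi_less[of y z1] psiZ[OF zz(1)] psiZ[OF zz(2)] by simp_all
      have pos: "sgn a = sgn b" if "0 < s * a" "0 < s * b" for a b
        using that s(1) by (auto simp: sgn_if zero_less_mult_iff)
      have neg: "sgn a = sgn b" if "s * a < 0" "s * b < 0" for a b
        using that s(1) by (auto simp: sgn_if mult_less_0_iff)
      have same: "s * poly p2 (\<phi> z0) < 0 \<longleftrightarrow> s * poly p z0 < 0" "0 < s * poly p2 (\<phi> z1) \<longleftrightarrow> 0 < s * poly p z1"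
        using sgn_eq_mult_iff[OF val[OF zz(1)], of s] sgn_eq_mult_iff[OF val[OF zz(2)], of s] by blast+
      \<comment> \<open>Since \<open>s * p\<close> increases across the gap, it has a root inside exactly in the third case.\<close>
      consider "s * poly p z0 \<ge> 0" | "s * poly p z1 \<le> 0" | "s * poly p z0 < 0" "s * poly p z1 > 0"
        by linarith
      then show ?thesis
      proof cases
        case 1
        have "s * poly p z0 < s * poly p y" by (rule s(2)) (use z in linarith)+
        moreover have "s * poly p2 (\<phi> z0) < s * poly p2 (\<psi> y)" by (rule s(3)) (use py in linarith)+
        ultimately show ?thesis using 1 same(1) by (intro pos) linarith+
      next
        case 2
        have "s * poly p y < s * poly p z1" by (rule s(2)) (use z in linarith)+
        moreover have "s * poly p2 (\<psi> y) < s * poly p2 (\<phi> z1)" by (rule s(3)) (use py in linarith)+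
        ultimately show ?thesis using 2 same(2) by (intro neg) linarith+
      next
        case 3
        then obtain w where w: "z0 < w" "w < z1" "poly p w = 0"
          using poly_IVT_pos[of z0 z1 "smult s p"] zz s(1) by auto
        have "w \<notin> Z" using z(1) w by (auto simp: gap_def)
        then have u: "corr w (\<psi> w)" using f_corr[of w] psi(2)[of w] w by (auto simp: W_def)
        then have u': "\<phi> z0 < \<psi> w" "\<psi> w < \<phi> z1" "poly p2 (\<psi> w) = 0"
          using w zz by (auto simp: corr_def)
        consider "y = w" | "y < w" | "w < y" by linarith
        then show ?thesis
        proof cases
          case 1 then show ?thesis using w u' by simp
        next
          case 2
          have "s * poly p y < s * poly p w" by (rule s(2)) (use 2 z w in linarith)+
          moreover have "s * poly p2 (\<psi> y) < s * poly p2 (\<psi> w)" by (rule s(3)) (use 2 py u' psi_less[of y w] in simp_all)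
          ultimately show ?thesis using w(3) u'(3) by (intro neg) simp_all
        next
          case 3
          have "s * poly p w < s * poly p y" by (rule s(2)) (use 3 z w in linarith)+
          moreover have "s * poly p2 (\<psi> w) < s * poly p2 (\<psi> y)" by (rule s(3)) (use 3 py u' psi_less[of w y] in simp_all)
          ultimately show ?thesis using w(3) u'(3) by (intro pos) simp_all
        qed
      qed
    qed
  qed
  then show ?thesis using psi(1) psiZ by blast
qed

text \<open>To the left of all roots of \<open>p\<close> and \<open>p'\<close> the polynomial is monotone without a sign change. If
  \<open>p\<close> and \<open>p'\<close> had the same sign there, \<open>p\<close> would stay bounded towards minus infinity.\<close>

lemma sgn_poly_below_roots:
  fixes p :: "real poly"
  assumes "degree p > 0"
    and "\<And>y. y \<le> a \<Longrightarrow> poly p y \<noteq> 0" "\<And>y. y \<le> a \<Longrightarrow> poly (pderiv p) y \<noteq> 0"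
  shows "sgn (poly p a) = - sgn (poly (pderiv p) a)"
proof -
  define s where "s = sgn (poly (pderiv p) a)"
  have s: "s \<noteq> 0" "sgn s = s" using assms(3)[of a] unfolding s_def by (simp_all add: sgn_eq_0_iff)
  have d: "sgn (poly (pderiv p) t) = s" if "t \<le> a" for t
    unfolding s_def by (rule sgn_poly_eq_of_no_root, rule assms(3)) (use that in auto)
  have mono: "s * poly p b < s * poly p a" if "b < a" for b
    by (rule poly_mono_of_sgn_pderiv) (use that s d in auto)
  have sg: "sgn (poly p b) = sgn (poly p a)" if "b \<le> a" for b
    by (rule sgn_poly_eq_of_no_root, rule assms(2)) (use that in auto)
  have "s * poly p a < 0"
  proof (rule ccontr)
    assume "\<not> s * poly p a < 0"
    moreover have "s * poly p a \<noteq> 0" using s(1) assms(2)[of a] by simp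
    ultimately have pos: "s * poly p a > 0" by linarith
    have bound: "\<bar>s * poly p b\<bar> \<le> s * poly p a" if "b \<le> a" for b
    proof -
      have "0 < s * poly p b" using sgn_eq_mult_iff(2)[OF sg[OF that], of s] pos by blast
      moreover have "s * poly p b \<le> s * poly p a" using mono[of b] that by (cases "b = a") auto
      ultimately show ?thesis by linarith
    qed
    have "filterlim (\<lambda>x. norm (poly p x)) at_top at_infinity"
      using filterlim_poly_at_infinity[OF assms(1)] by (simp add: filterlim_at_infinity_conv_norm_at_top)
    then have "eventually (\<lambda>x. \<bar>poly p a\<bar> + 1 \<le> norm (poly p x)) at_infinity"
      by (simp add: filterlim_at_top)
    then obtain r where r: "\<And>z. r \<le> norm z \<Longrightarrow> \<bar>poly p a\<bar> + 1 \<le> norm (poly p z)"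
      unfolding eventually_at_infinity by blast
    define b where "b = - \<bar>a\<bar> - \<bar>r\<bar>"
    have "\<bar>s\<bar> * (\<bar>poly p a\<bar> + 1) \<le> \<bar>s\<bar> * \<bar>poly p b\<bar>"
      using r[of b] by (intro mult_left_mono) (auto simp: b_def)
    also have "\<dots> = \<bar>s * poly p b\<bar>" by (simp add: abs_mult)
    also have "\<dots> \<le> s * poly p a" by (rule bound) (simp add: b_def)
    also have "\<dots> \<le> \<bar>s\<bar> * \<bar>poly p a\<bar>" by (metis abs_ge_self abs_mult)
    finally have "\<bar>s\<bar> \<le> 0" by (simp add: algebra_simps)
    then show False using s(1) by simp
  qed
  then have "sgn s * sgn (poly p a) = -1" by (metis sgn_mult sgn_neg)
  moreover have "sgn s = 1 \<or> sgn s = -1" using s(1) by (metis sgn_neg sgn_pos linorder_neqE)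
  ultimately have "sgn (poly p a) = - sgn s" by (elim disjE) simp_all
  then show ?thesis by (simp only: s(2) s_def[symmetric])
qed

lemma sgn_poly_above_roots:
  fixes p :: "real poly"
  assumes "degree p > 0"
    and "\<And>y. a \<le> y \<Longrightarrow> poly p y \<noteq> 0" "\<And>y. a \<le> y \<Longrightarrow> poly (pderiv p) y \<noteq> 0"
  shows "sgn (poly p a) = sgn (poly (pderiv p) a)"
proof -
  define q where "q = pcompose p [:0, -1:]"
  have q: "poly q y = poly p (- y)" "poly (pderiv q) y = - poly (pderiv p) (- y)" for y
    by (simp_all add: q_def poly_pcompose pderiv_pcompose pderiv_pCons)
  have "degree q = degree p" by (simp add: q_def degree_pcompose)
  then have "sgn (poly q (- a)) = - sgn (poly (pderiv q) (- a))"
    by (intro sgn_poly_below_roots) (use assms q in auto)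
  then show ?thesis by (simp add: q sgn_minus)
qed

text \<open>The inductive step of the elimination. \<open>B\<close> pairs the polynomials over one parameter with those over
  another, and \<open>\<phi>\<close> already matches their signs; the pair of derivatives is among them. The
  hypothesis \<open>val\<close> is what the remainders of \<open>p\<close> modulo the members of \<open>B\<close> will supply.\<close>

lemma sign_iso_insert:
  fixes p p2 :: "real poly" and B :: "(real poly \<times> real poly) set"
  assumes fin: "finite B" and phi: "order_iso \<phi>"
    and sg: "\<And>q r y. (q, r) \<in> B \<Longrightarrow> sgn (poly r (\<phi> y)) = sgn (poly q y)"
    and der: "(pderiv p, pderiv p2) \<in> B" "degree p > 0" "degree p2 > 0"
    and val: "\<And>q r y. (q, r) \<in> B \<Longrightarrow> q \<noteq> 0 \<Longrightarrow> poly q y = 0 \<Longrightarrow> sgn (poly p2 (\<phi> y)) = sgn (poly p y)"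
  shows "\<exists>\<psi>. order_iso \<psi> \<and>
    (\<forall>(q, r)\<in>insert (p, p2) B. \<forall>y. sgn (poly r (\<psi> y)) = sgn (poly q y))"
proof -
  have less_iff: "\<phi> a < \<phi> b \<longleftrightarrow> a < b" for a b
    using phi strict_mono_less by blast
  have inj: "inj \<phi>" using phi strict_mono_imp_inj_on by blast
  have root_iff: "poly r (\<phi> y) = 0 \<longleftrightarrow> poly q y = 0" if "(q, r) \<in> B" for q r y
    using sg[OF that, of y] by (metis sgn_eq_0_iff)
  define Z where "Z = (\<Union>(q, r)\<in>B. {y. q \<noteq> 0 \<and> poly q y = 0})"
  have "finite {y. q \<noteq> 0 \<and> poly q y = 0}" for q :: "real poly"
    by (cases "q = 0") (auto simp: poly_roots_finite)
  then have finZ: "finite Z" unfolding Z_def using fin by auto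
  have p0: "p \<noteq> 0" "p2 \<noteq> 0" "pderiv p \<noteq> 0" "pderiv p2 \<noteq> 0" using der by (auto simp: pderiv_eq_0_iff)
  define V where "V = Z \<union> {y. poly p y = 0} \<union> \<phi> -` {y. poly p2 y = 0}"
  have finV: "finite V"
    unfolding V_def using finZ p0 inj
    by (intro finite_UnI finite_vimageI poly_roots_finite) auto
  \<comment> \<open>Two further matching points, outside all roots on both sides; the signs of \<open>p\<close> and \<open>p2\<close> there are
    determined by the derivatives.\<close>
  define lo hi where "lo = Min (insert 0 V) - 1" and "hi = Max (insert 0 V) + 1"
  have lov: "lo < v" if "v \<in> V" for v
  proof -
    have "Min (insert 0 V) \<le> v" using that finV by (intro Min_le) auto
    then show ?thesis unfolding lo_def by linarith
  qed
  have hiv: "v < hi" if "v \<in> V" for v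
  proof -
    have "v \<le> Max (insert 0 V)" using that finV by (intro Max_ge) auto
    then show ?thesis unfolding hi_def by linarith
  qed
  have dZ: "poly (pderiv p) y \<noteq> 0" if "y \<notin> Z" for y
    using that der p0 unfolding Z_def by force
  have d2: "poly (pderiv p2) (\<phi> y) \<noteq> 0" if "y \<notin> Z" for y
    using root_iff[OF der(1)] dZ that by blast
  have ZV: "Z \<subseteq> V" by (auto simp: V_def)
  have p2V: "poly p2 (\<phi> y) \<noteq> 0" if "y \<notin> V" for y using that by (auto simp: V_def)
  have pV: "poly p y \<noteq> 0" if "y \<notin> V" for y using that by (auto simp: V_def)
  have lolo: "y \<notin> V" if "y \<le> lo" for y using lov that by fastforce
  have hihi: "y \<notin> V" if "hi \<le> y" for y using hiv that by fastforce
  have lolo2: "\<exists>x\<le>lo. y = \<phi> x" if "y \<le> \<phi> lo" for y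
    using that phi by (metis surjD strict_mono_less_eq)
  have hihi2: "\<exists>x\<ge>hi. y = \<phi> x" if "\<phi> hi \<le> y" for y
    using that phi by (metis surjD strict_mono_less_eq)
  have slo: "sgn (poly p2 (\<phi> lo)) = sgn (poly p lo)"
  proof -
    have "sgn (poly p lo) = - sgn (poly (pderiv p) lo)"
      by (rule sgn_poly_below_roots) (use der lolo ZV pV dZ in auto)
    moreover have "sgn (poly p2 (\<phi> lo)) = - sgn (poly (pderiv p2) (\<phi> lo))"
      by (rule sgn_poly_below_roots) (use der lolo lolo2 ZV p2V d2 in blast)+
    ultimately show ?thesis using sg[OF der(1)] by simp
  qed
  have shi: "sgn (poly p2 (\<phi> hi)) = sgn (poly p hi)"
  proof -
    have "sgn (poly p hi) = sgn (poly (pderiv p) hi)"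
      by (rule sgn_poly_above_roots) (use der hihi ZV pV dZ in auto)
    moreover have "sgn (poly p2 (\<phi> hi)) = sgn (poly (pderiv p2) (\<phi> hi))"
      by (rule sgn_poly_above_roots) (use der hihi hihi2 ZV p2V d2 in blast)+
    ultimately show ?thesis using sg[OF der(1)] by simp
  qed
  have "\<exists>\<psi>. order_iso \<psi> \<and> (\<forall>z\<in>insert lo (insert hi Z). \<psi> z = \<phi> z) \<and>
             (\<forall>y. sgn (poly p2 (\<psi> y)) = sgn (poly p y))"
  proof (rule sign_iso_of_critical_signs[where lo=lo and hi=hi])
    fix z assume "z \<in> insert lo (insert hi Z)"
    then show "sgn (poly p2 (\<phi> z)) = sgn (poly p z)"
      using slo shi val unfolding Z_def by auto
  next
    fix y assume "y \<le> \<phi> lo" then show "poly p2 y \<noteq> 0" using lolo lolo2 p2V by blast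
  next
    fix y assume "\<phi> hi \<le> y" then show "poly p2 y \<noteq> 0" using hihi hihi2 p2V by blast
  next
    fix y assume "y \<notin> insert lo (insert hi Z)"
    then show "poly (pderiv p) y \<noteq> 0" using dZ by blast
  next
    fix y assume "y \<le> lo" then show "poly p y \<noteq> 0" using lolo pV by blast
  next
    fix y assume "hi \<le> y" then show "poly p y \<noteq> 0" using hihi pV by blast
  qed (simp_all add: finZ phi sg[OF der(1)])
  then obtain \<psi> where psi: "order_iso \<psi>" "\<And>z. z \<in> Z \<Longrightarrow> \<psi> z = \<phi> z"
    "\<And>y. sgn (poly p2 (\<psi> y)) = sgn (poly p y)" by auto
  have psi_less: "\<psi> a < \<psi> b \<longleftrightarrow> a < b" for a b
    using psi(1) strict_mono_less by blast
  have "sgn (poly r (\<psi> y)) = sgn (poly q y)" if qr: "(q, r) \<in> B" for q r y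
  proof (cases "y \<in> Z \<or> q = 0")
    case True
    then show ?thesis
    proof
      assume "y \<in> Z" then show ?thesis using psi(2) sg[OF qr] by simp
    next
      assume q: "q = 0"
      obtain x where "\<psi> y = \<phi> x" using phi by (metis surjD)
      then show ?thesis using sg[OF qr, of x] q by simp
    qed
  next
    case False
    \<comment> \<open>\<open>\<psi>\<close> and \<open>\<phi>\<close> agree on the roots, so they send \<open>y\<close> into the same gap between roots of \<open>r\<close>.\<close>
    have "sgn (poly r (\<psi> y)) = sgn (poly r (\<phi> y))"
    proof (rule sgn_poly_eq_of_no_root)
      fix t assume t: "min (\<psi> y) (\<phi> y) \<le> t" "t \<le> max (\<psi> y) (\<phi> y)"
      obtain x where x: "t = \<phi> x" using phi by (metis surjD)
      show "poly r t \<noteq> 0"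
      proof
        assume "poly r t = 0"
        then have "x \<in> Z" using root_iff[OF qr] x False qr unfolding Z_def by auto
        then have "\<psi> x = \<phi> x" "x \<noteq> y" using psi(2) False by auto
        then show False using t x less_iff[of x y] less_iff[of y x] psi_less[of x y] psi_less[of y x]
          by (auto simp: min_def max_def split: if_splits)
      qed
    qed
    then show ?thesis using sg[OF qr] by simp
  qed
  then show ?thesis using psi by auto
qed

section \<open>Fibrewise sign patterns of polynomials with parameters\<close>

definition same_signs :: "('a \<Rightarrow> real) set \<Rightarrow> 'a \<Rightarrow> 'a \<Rightarrow> bool" where
  "same_signs Q x x' \<longleftrightarrow> (\<forall>q\<in>Q. sgn (q x) = sgn (q x'))"

text \<open>The members of \<open>\<F>\<close> are polynomials in one variable that depend on a parameter; \<open>\<phi>\<close> transports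
  their sign pattern at the parameter \<open>x\<close> to the one at \<open>x'\<close>.\<close>

definition fibre_sign_iso :: "('a \<Rightarrow> real poly) set \<Rightarrow> (real \<Rightarrow> real) \<Rightarrow> 'a \<Rightarrow> 'a \<Rightarrow> bool" where
  "fibre_sign_iso \<F> \<phi> x x' \<longleftrightarrow> order_iso \<phi> \<and> (\<forall>F\<in>\<F>. \<forall>y. sgn (poly (F x') (\<phi> y)) = sgn (poly (F x) y))"

text \<open>The coefficients of the parametrised polynomials are taken from an algebra of functions of the
  parameter, so that the elimination does not depend on how the parameter space is described.\<close>

locale function_algebra =
  fixes A :: "('a \<Rightarrow> real) set"
  assumes const_mem: "(\<lambda>x. c) \<in> A"
    and add_mem: "f \<in> A \<Longrightarrow> g \<in> A \<Longrightarrow> (\<lambda>x. f x + g x) \<in> A"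
    and mult_mem: "f \<in> A \<Longrightarrow> g \<in> A \<Longrightarrow> (\<lambda>x. f x * g x) \<in> A"
begin

lemma diff_mem: "f \<in> A \<Longrightarrow> g \<in> A \<Longrightarrow> (\<lambda>x. f x - g x) \<in> A"
  using add_mem[OF _ mult_mem[OF const_mem[of "-1"]], of f g] by simp

lemma sum_mem: "finite I \<Longrightarrow> (\<And>i. i \<in> I \<Longrightarrow> f i \<in> A) \<Longrightarrow> (\<lambda>x. \<Sum>i\<in>I. f i x) \<in> A"
  by (induction I rule: finite_induct) (auto intro: const_mem add_mem)

text \<open>The bound \<open>d\<close> is formal: even the coefficient of index \<open>d - 1\<close> may vanish, for some or for all
  parameters. Counting coefficients instead of degrees leaves \<open>d = 0\<close> for the zero polynomial.\<close>

definition param_poly :: "nat \<Rightarrow> ('a \<Rightarrow> real poly) \<Rightarrow> bool" where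
  "param_poly d F \<longleftrightarrow> (\<forall>i. (\<lambda>x. coeff (F x) i) \<in> A) \<and> (\<forall>x. \<forall>i\<ge>d. coeff (F x) i = 0)"

lemma param_poly_const: "f \<in> A \<Longrightarrow> param_poly 1 (\<lambda>x. [:f x:])"
  unfolding param_poly_def
proof (intro conjI allI impI)
  fix i assume f: "f \<in> A" show "(\<lambda>x. coeff [:f x:] i) \<in> A"
    using f const_mem[of 0] by (cases i) (simp_all add: coeff_pCons)
qed (simp add: coeff_pCons split: nat.split)

lemma param_poly_var: "param_poly 2 (\<lambda>x. [:0, 1:])"
  unfolding param_poly_def by (auto simp: coeff_pCons const_mem split: nat.split)

lemma param_poly_add:
  assumes "param_poly d F" "param_poly e G"
  shows "param_poly (max d e) (\<lambda>x. F x + G x)"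
  using assms unfolding param_poly_def by (auto intro: add_mem)

lemma param_poly_mult:
  assumes "param_poly d F" "param_poly e G"
  shows "param_poly (d + e) (\<lambda>x. F x * G x)"
proof -
  have "coeff (F x) k * coeff (G x) (i - k) = 0" if "i \<ge> d + e" for x i k
    using that assms unfolding param_poly_def by (cases "k \<ge> d") auto
  then show ?thesis
    using assms unfolding param_poly_def coeff_mult
    by (intro conjI allI impI sum_mem mult_mem sum.neutral ballI) auto
qed

lemma param_poly_pderiv:
  assumes "param_poly d F"
  shows "param_poly (d - 1) (\<lambda>x. pderiv (F x))"
  using assms unfolding param_poly_def coeff_pderiv
  by (auto intro: mult_mem const_mem)

lemma param_poly_truncate:
  assumes "param_poly (Suc e) F"
  shows "param_poly e (\<lambda>x. F x - monom (coeff (F x) e) e)"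
proof -
  have eq: "(\<lambda>x. coeff (F x - monom (coeff (F x) e) e) i) = (if i = e then (\<lambda>x. 0) else (\<lambda>x. coeff (F x) i))" for i
    by auto
  show ?thesis
    using assms const_mem[of 0] unfolding param_poly_def eq by (auto simp: le_Suc_eq)
qed

text \<open>One step of pseudo-division. The factor in front of \<open>F\<close> is the square of the leading coefficient
  of the divisor, so that signs survive without knowing the sign of that coefficient.\<close>

lemma param_poly_reduce:
  assumes F: "param_poly (Suc d) F" and G: "param_poly (Suc e) G" and "e \<le> d"
  shows "param_poly d (\<lambda>x. smult ((coeff (G x) e)\<^sup>2) (F x)
                          - smult (coeff (F x) d * coeff (G x) e) (monom 1 (d - e) * G x))"
    (is "param_poly d ?H")
proof -
  have c: "coeff (?H x) i = (coeff (G x) e)\<^sup>2 * coeff (F x) i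
      - coeff (F x) d * coeff (G x) e * (if i < d - e then 0 else coeff (G x) (i - (d - e)))" for x i
    by (simp add: coeff_monom_mult)
  have "(\<lambda>x. coeff (?H x) i) \<in> A" for i
    unfolding c using F G unfolding param_poly_def
    by (cases "i < d - e") (auto intro!: diff_mem mult_mem const_mem simp: power2_eq_square)
  moreover have "coeff (?H x) i = 0" if "i \<ge> d" for x i
  proof (cases "i = d")
    case True
    have "d - (d - e) = e" using \<open>e \<le> d\<close> by simp
    then show ?thesis unfolding c using True by (simp add: power2_eq_square)
  next
    case False
    then have "Suc d \<le> i" "Suc e \<le> i - (d - e)" using that \<open>e \<le> d\<close> by auto
    then show ?thesis unfolding c using F G unfolding param_poly_def by simp
  qed
  ultimately show ?thesis unfolding param_poly_def by blast
qed

lemma pseudo_remainder: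
  assumes "param_poly d F" and G: "param_poly (Suc e) G"
  shows "\<exists>R. param_poly e R \<and> (\<forall>x y. coeff (G x) e \<noteq> 0 \<longrightarrow> poly (G x) y = 0 \<longrightarrow>
                sgn (poly (R x) y) = sgn (poly (F x) y))"
  using assms(1)
proof (induction d arbitrary: F)
  case 0
  then have "param_poly e F" unfolding param_poly_def by auto
  then show ?case by blast
next
  case (Suc d)
  show ?case
  proof (cases "e \<le> d")
    case False
    then have "param_poly e F" using Suc.prems unfolding param_poly_def by auto
    then show ?thesis by blast
  next
    case True
    define H where "H x = smult ((coeff (G x) e)\<^sup>2) (F x)
                          - smult (coeff (F x) d * coeff (G x) e) (monom 1 (d - e) * G x)" for x
    have "param_poly d H"
      using param_poly_reduce[OF Suc.prems G True] by (simp add: H_def[abs_def])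
    then obtain R where R: "param_poly e R"
      "\<And>x y. coeff (G x) e \<noteq> 0 \<Longrightarrow> poly (G x) y = 0 \<Longrightarrow> sgn (poly (R x) y) = sgn (poly (H x) y)"
      using Suc.IH by blast
    have "sgn (poly (H x) y) = sgn (poly (F x) y)" if "coeff (G x) e \<noteq> 0" "poly (G x) y = 0" for x y
    proof -
      have "poly (H x) y = (coeff (G x) e)\<^sup>2 * poly (F x) y" using that by (simp add: H_def)
      moreover have "(coeff (G x) e)\<^sup>2 > 0" using that by simp
      ultimately show ?thesis by (simp only: sgn_mult sgn_pos mult_1)
    qed
    then show ?thesis using R by (intro exI[of _ R]) simp
  qed
qed

text \<open>Induction on the multiset of formal degree bounds. A polynomial of largest bound is replaced by its
  derivative and by remainders, all of smaller bound, which lowers the multiset. This is justified only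
  for parameters where no formal leading coefficient vanishes; for the others, a polynomial whose
  leading coefficient vanishes may be truncated, which lowers the multiset as well. The set \<open>Q\<close> contains
  the leading coefficients, so two parameters with equal signs on \<open>Q\<close> fall under the same case.\<close>

lemma fibre_sign_iso_of_multiset:
  fixes M :: "(('a \<Rightarrow> real poly) \<times> nat) multiset"
  assumes "\<And>F d. (F, d) \<in># M \<Longrightarrow> param_poly d F"
  shows "\<exists>Q. finite Q \<and> Q \<subseteq> A \<and>
     (\<forall>x x'. same_signs Q x x' \<longrightarrow> (\<exists>\<phi>. fibre_sign_iso (fst ` set_mset M) \<phi> x x'))"
  using assms
proof (induction "image_mset snd M" arbitrary: M rule: wf_induct_rule[OF wf_mult1[OF wf_less_than]])
  case 1
  note IH = 1(1) and pp = 1(2)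
  show ?case
  proof (cases "\<forall>z\<in>#M. snd z \<le> 1")
    case True
    define Q where "Q = (\<lambda>z x. coeff (fst z x) 0) ` set_mset M"
    have "Q \<subseteq> A" using pp unfolding Q_def param_poly_def by auto
    moreover have "fibre_sign_iso (fst ` set_mset M) id x x'" if "same_signs Q x x'" for x x'
    proof -
      have "poly (F x) y = coeff (F x) 0" if "(F, d) \<in># M" for F d x y
      proof -
        have "coeff (F x) i = 0" if "i > 0" for i
          using pp[OF \<open>(F, d) \<in># M\<close>] True \<open>(F, d) \<in># M\<close> that unfolding param_poly_def by fastforce
        then have "degree (F x) = 0" by (metis leading_coeff_0_iff degree_0 gr0I)
        then obtain c where "F x = [:c:]" by (rule degree_eq_zeroE)
        then show ?thesis by simp
      qed
      then show ?thesis using that unfolding fibre_sign_iso_def same_signs_def Q_def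
        by (force simp: strict_mono_def)
    qed
    moreover have "finite Q" by (simp add: Q_def)
    ultimately show ?thesis by blast
  next
    case False
    define d where "d = Max (snd ` set_mset M)"
    have dmax: "snd z \<le> d" if "z \<in># M" for z unfolding d_def using that by auto
    have "d \<in> snd ` set_mset M" unfolding d_def using False by (intro Max_in) auto
    then obtain F where F: "(F, d) \<in># M" by auto
    have d2: "d \<ge> 2" using False dmax by force
    define N where "N = M - {#(F, d)#}"
    have M: "M = add_mset (F, d) N" using F by (simp add: N_def)
    define N' where "N' = add_mset ((\<lambda>x. pderiv (F x)), d - 1) N"
    have ppN': "param_poly (snd z) (fst z)" if "z \<in># N'" for z
      using that pp[of "fst z" "snd z"] param_poly_pderiv[OF pp[OF F]] unfolding N'_def M by auto
    have "\<exists>R. z \<in># N' \<longrightarrow> param_poly (snd z - 1) R \<and> (\<forall>x y. snd z \<ge> 1 \<longrightarrow> coeff (fst z x) (snd z - 1) \<noteq> 0 \<longrightarrow>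
        poly (fst z x) y = 0 \<longrightarrow> sgn (poly (R x) y) = sgn (poly (F x) y))" for z
    proof (cases "snd z")
      case 0
      have "param_poly 0 (\<lambda>x. 0)" by (simp add: param_poly_def const_mem)
      then show ?thesis using 0 by auto
    next
      case (Suc e)
      then show ?thesis using pseudo_remainder[OF pp[OF F], of e "fst z"] ppN'[of z] by (cases "z \<in># N'") auto
    qed
    then obtain R where R: "\<And>z. z \<in># N' \<Longrightarrow> param_poly (snd z - 1) (R z)"
      "\<And>z x y. z \<in># N' \<Longrightarrow> snd z \<ge> 1 \<Longrightarrow> coeff (fst z x) (snd z - 1) \<noteq> 0 \<Longrightarrow>
        poly (fst z x) y = 0 \<Longrightarrow> sgn (poly (R z x) y) = sgn (poly (F x) y)"
      by metis
    \<comment> \<open>The elements of \<open>N'\<close> are kept and their remainders added; only \<open>F\<close> itself is dropped.\<close>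
    define M' where "M' = N' + image_mset (\<lambda>z. (R z, snd z - 1)) N'"
    have "(image_mset snd M', image_mset snd M) \<in> mult1 less_than"
    proof (rule mult1I)
      show "image_mset snd M = add_mset d (image_mset snd N)" by (simp add: M)
      show "image_mset snd M' = image_mset snd N + add_mset (d - 1) (image_mset (\<lambda>z. snd z - 1) N')"
        by (simp add: M'_def N'_def multiset.map_comp comp_def)
      fix b assume "b \<in># add_mset (d - 1) (image_mset (\<lambda>z. snd z - 1) N')"
      then show "(b, d) \<in> less_than" using dmax d2 unfolding N'_def M by fastforce
    qed
    moreover have "param_poly e G" if "(G, e) \<in># M'" for G e
      using that R(1) ppN'[of "(G, e)"] unfolding M'_def by auto
    ultimately obtain Q' where Q': "finite Q'" "Q' \<subseteq> A"
      "\<And>x x'. same_signs Q' x x' \<Longrightarrow> \<exists>\<phi>. fibre_sign_iso (fst ` set_mset M') \<phi> x x'"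
      using IH[of M'] by blast
    \<comment> \<open>A bound of \<open>0\<close> belongs to the zero polynomial, which has no leading coefficient to be tested.\<close>
    define T where "T = {z. z \<in># M \<and> snd z \<ge> 1}"
    have finT: "finite T" by (simp add: T_def)
    define top where "top z x = coeff (fst z x) (snd z - 1)" for z :: "('a \<Rightarrow> real poly) \<times> nat" and x
    define trunc where "trunc z = ((\<lambda>x. fst z x - monom (top z x) (snd z - 1)), snd z - 1)" for z
    have "\<exists>Q. finite Q \<and> Q \<subseteq> A \<and> (\<forall>x x'. same_signs Q x x' \<longrightarrow>
            (\<exists>\<phi>. fibre_sign_iso (fst ` set_mset (add_mset (trunc z) (M - {#z#}))) \<phi> x x'))" if z: "z \<in> T" for z
    proof (rule IH)
      have zM: "z \<in># M" "snd z \<ge> 1" using z by (auto simp: T_def)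
      show "(image_mset snd (add_mset (trunc z) (M - {#z#})), image_mset snd M) \<in> mult1 less_than"
      proof (rule mult1I)
        show "image_mset snd M = add_mset (snd z) (image_mset snd (M - {#z#}))"
          using zM by (metis image_mset_add_mset insert_DiffM)
        show "image_mset snd (add_mset (trunc z) (M - {#z#})) = image_mset snd (M - {#z#}) + {#snd z - 1#}"
          by (simp add: trunc_def)
      qed (use zM in auto)
      fix G e assume "(G, e) \<in># add_mset (trunc z) (M - {#z#})"
      then consider "(G, e) = trunc z" | "(G, e) \<in># M" by (auto dest: in_diffD)
      then show "param_poly e G"
      proof cases
        case 1
        then show ?thesis
          using param_poly_truncate[of "snd z - 1" "fst z"] zM pp[of "fst z" "snd z"]
          by (auto simp: trunc_def top_def)
      qed (rule pp)
    qed
    then obtain QT where QT: "\<And>z. z \<in> T \<Longrightarrow> finite (QT z)" "\<And>z. z \<in> T \<Longrightarrow> QT z \<subseteq> A"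
      "\<And>z x x'. z \<in> T \<Longrightarrow> same_signs (QT z) x x' \<Longrightarrow>
            \<exists>\<phi>. fibre_sign_iso (fst ` set_mset (add_mset (trunc z) (M - {#z#}))) \<phi> x x'"
      by metis
    define Q where "Q = top ` T \<union> Q' \<union> (\<Union>z\<in>T. QT z)"
    have "finite Q" unfolding Q_def using finT Q' QT by auto
    moreover have "top z \<in> A" if "z \<in> T" for z
      using pp[of "fst z" "snd z"] that unfolding T_def top_def[abs_def] param_poly_def by auto
    then have "Q \<subseteq> A" unfolding Q_def using Q' QT by blast
    moreover have "\<exists>\<phi>. fibre_sign_iso (fst ` set_mset M) \<phi> x x'" if ss: "same_signs Q x x'" for x x'
    proof -
      have ssT: "sgn (top z x) = sgn (top z x')" "same_signs (QT z) x x'" if "z \<in> T" for z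
        using ss that unfolding same_signs_def Q_def by auto
      have ss': "same_signs Q' x x'" using ss unfolding same_signs_def Q_def by auto
      show ?thesis
      proof (cases "\<exists>z\<in>T. top z x = 0")
        case True
        then obtain z where z: "z \<in> T" "top z x = 0" by blast
        then have z': "top z x' = 0" using ssT[of z] by (metis sgn_eq_0_iff)
        obtain \<phi> where \<phi>: "fibre_sign_iso (fst ` set_mset (add_mset (trunc z) (M - {#z#}))) \<phi> x x'"
          using QT(3)[OF z(1) ssT(2)[OF z(1)]] by blast
        have "sgn (poly (G x') (\<phi> y)) = sgn (poly (G x) y)" if "(G, e) \<in># M" for G e y
        proof (cases "(G, e) = z")
          case True
          have "fst (trunc z) x = G x" "fst (trunc z) x' = G x'"
            using True z z' by (auto simp: trunc_def)
          then show ?thesis using \<phi> unfolding fibre_sign_iso_def by (metis UnCI image_eqI insertI1 set_mset_add_mset_insert)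
        next
          case False
          then have "(G, e) \<in># M - {#z#}" using that by (simp add: in_diff_count)
          then show ?thesis using \<phi> unfolding fibre_sign_iso_def by force
        qed
        then show ?thesis using \<phi> unfolding fibre_sign_iso_def by (intro exI[of _ \<phi>]) auto
      next
        case False
        then have top0: "top z x \<noteq> 0" "top z x' \<noteq> 0" if "z \<in> T" for z
          using that ssT[OF that] by (metis, metis sgn_eq_0_iff)
        obtain \<phi> where \<phi>: "order_iso \<phi>"
          "\<And>G y. G \<in> fst ` set_mset M' \<Longrightarrow> sgn (poly (G x') (\<phi> y)) = sgn (poly (G x) y)"
          using Q'(3)[OF ss'] unfolding fibre_sign_iso_def by blast
        have topN: "coeff (fst z u) (snd z - 1) \<noteq> 0" if z: "z \<in># N'" "snd z \<ge> 1" and u: "u = x \<or> u = x'" for z u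
        proof (cases "z \<in># N")
          case True
          then have "z \<in> T" using z by (auto simp: T_def M)
          then show ?thesis using top0 u unfolding top_def by blast
        next
          case False
          then have zz: "z = ((\<lambda>x. pderiv (F x)), d - 1)" using z by (auto simp: N'_def)
          have "(F, d) \<in> T" using F d2 by (auto simp: T_def)
          then have "coeff (F u) (d - 1) \<noteq> 0" using top0[of "(F, d)"] u by (auto simp: top_def)
          moreover have "Suc (d - 1 - 1) = d - 1" using d2 by simp
          ultimately show ?thesis by (simp add: zz coeff_pderiv)
        qed
        define B where "B = (\<lambda>z. (fst z x, fst z x')) ` set_mset N'"
        have N'M': "fst z \<in> fst ` set_mset M'" "R z \<in> fst ` set_mset M'" if "z \<in># N'" for z
          using that unfolding M'_def by (auto intro: rev_image_eqI)
        have degF: "degree (F u) > 0" if "u = x \<or> u = x'" for u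
        proof -
          have "(F, d) \<in> T" using F d2 by (auto simp: T_def)
          then have "coeff (F u) (d - 1) \<noteq> 0" using top0[of "(F, d)"] that by (auto simp: top_def)
          then have "d - 1 \<le> degree (F u)" by (rule le_degree)
          then show ?thesis using d2 by simp
        qed
        have "\<exists>\<psi>. order_iso \<psi> \<and> (\<forall>(q, r)\<in>insert (F x, F x') B. \<forall>y. sgn (poly r (\<psi> y)) = sgn (poly q y))"
        proof (rule sign_iso_insert[OF _ \<phi>(1)])
          show "finite B" by (simp add: B_def)
          show "(pderiv (F x), pderiv (F x')) \<in> B"
            unfolding B_def N'_def by (intro image_eqI[of _ _ "((\<lambda>x. pderiv (F x)), d - 1)"]) auto
          show "degree (F x) > 0" "degree (F x') > 0" using degF by auto
          fix q r y assume "(q, r) \<in> B"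
          then obtain z where z: "z \<in># N'" "q = fst z x" "r = fst z x'" by (auto simp: B_def)
          show s: "sgn (poly r (\<phi> y)) = sgn (poly q y)" using \<phi>(2)[OF N'M'(1)[OF z(1)]] z by simp
          assume q: "q \<noteq> 0" "poly q y = 0"
          have e1: "snd z \<ge> 1"
          proof (rule ccontr)
            assume "\<not> snd z \<ge> 1"
            then have "coeff (fst z x) i = 0" for i using ppN'[OF z(1)] unfolding param_poly_def by simp
            then show False using q z by (simp add: poly_eq_iff)
          qed
          have "poly r (\<phi> y) = 0" using s q by (simp add: sgn_eq_0_iff)
          then have "sgn (poly (R z x') (\<phi> y)) = sgn (poly (F x') (\<phi> y))"
            using R(2)[OF z(1) e1 topN[OF z(1) e1]] z by simp
          moreover have "sgn (poly (R z x) y) = sgn (poly (F x) y)"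
            using R(2)[OF z(1) e1 topN[OF z(1) e1]] z q by simp
          ultimately show "sgn (poly (F x') (\<phi> y)) = sgn (poly (F x) y)"
            using \<phi>(2)[OF N'M'(2)[OF z(1)], of y] by simp
        qed
        then obtain \<psi> where \<psi>: "order_iso \<psi>"
          "\<And>q r y. (q, r) \<in> insert (F x, F x') B \<Longrightarrow> sgn (poly r (\<psi> y)) = sgn (poly q y)" by blast
        have "(G x, G x') \<in> insert (F x, F x') B" if "(G, e) \<in># M" for G e
          using that unfolding M B_def N'_def by (auto intro: rev_image_eqI)
        then show ?thesis using \<psi> unfolding fibre_sign_iso_def by (intro exI[of _ \<psi>]) auto
      qed
    qed
    ultimately show ?thesis by blast
  qed
qed

lemma fibre_sign_iso_exists:
  assumes "finite \<F>" and "\<And>F. F \<in> \<F> \<Longrightarrow> \<exists>d. param_poly d F"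
  shows "\<exists>Q. finite Q \<and> Q \<subseteq> A \<and> (\<forall>x x'. same_signs Q x x' \<longrightarrow> (\<exists>\<phi>. fibre_sign_iso \<F> \<phi> x x'))"
proof -
  obtain d where d: "\<And>F. F \<in> \<F> \<Longrightarrow> param_poly (d F) F" using assms(2) by metis
  have "fst ` set_mset (image_mset (\<lambda>F. (F, d F)) (mset_set \<F>)) = \<F>"
    using assms(1) by (auto simp: image_image)
  then show ?thesis
    using fibre_sign_iso_of_multiset[of "image_mset (\<lambda>F. (F, d F)) (mset_set \<F>)"] d assms(1) by auto
qed

end

section \<open>Semialgebraic sets and their projections\<close>

text \<open>Semialgebraicity without normal forms: for the algebra of all polynomials this is equivalent to the
  usual definition, and it makes sense for any algebra of functions.\<close>

definition sign_determined :: "('a \<Rightarrow> real) set \<Rightarrow> 'a set \<Rightarrow> bool" where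
  "sign_determined A S \<longleftrightarrow>
     (\<exists>Q. finite Q \<and> Q \<subseteq> A \<and> (\<forall>x y. same_signs Q x y \<longrightarrow> (x \<in> S \<longleftrightarrow> y \<in> S)))"

lemma same_signs_Un: "same_signs (P \<union> Q) x y \<longleftrightarrow> same_signs P x y \<and> same_signs Q x y"
  by (auto simp: same_signs_def)

lemma same_signs_sym: "same_signs Q x y \<Longrightarrow> same_signs Q y x"
  by (simp add: same_signs_def)

lemma sign_determined_Int:
  assumes "sign_determined A S" "sign_determined A T"
  shows "sign_determined A (S \<inter> T)"
proof -
  obtain P Q where "finite P" "P \<subseteq> A" "\<And>x y. same_signs P x y \<Longrightarrow> (x \<in> S \<longleftrightarrow> y \<in> S)"
    "finite Q" "Q \<subseteq> A" "\<And>x y. same_signs Q x y \<Longrightarrow> (x \<in> T \<longleftrightarrow> y \<in> T)"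
    using assms unfolding sign_determined_def by metis
  then show ?thesis unfolding sign_determined_def
    by (intro exI[of _ "P \<union> Q"]) (auto simp: same_signs_Un)
qed

lemma sign_determined_Compl: "sign_determined A S \<Longrightarrow> sign_determined A (- S)"
  unfolding sign_determined_def by auto

lemma sign_determined_vimage:
  assumes "sign_determined A S" and "\<And>q. q \<in> A \<Longrightarrow> (\<lambda>x. q (g x)) \<in> B"
  shows "sign_determined B (g -` S)"
proof -
  obtain Q where "finite Q" "Q \<subseteq> A" "\<And>x y. same_signs Q x y \<Longrightarrow> (x \<in> S \<longleftrightarrow> y \<in> S)"
    using assms(1) unfolding sign_determined_def by metis
  then show ?thesis using assms(2) unfolding sign_determined_def same_signs_def
    by (intro exI[of _ "(\<lambda>q x. q (g x)) ` Q"]) auto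
qed

text \<open>For the converse direction, the finitely many sign vectors that occur on \<open>K\<close> each cut out a basic
  semialgebraic set, and \<open>K\<close> is their union.\<close>

lemma semialgebraic_iff_sign_determined:
  "semialgebraic K \<longleftrightarrow> sign_determined (Collect real_polynomial_function) K"
proof
  assume "semialgebraic K"
  then obtain \<B> where B: "finite \<B>" "\<And>B. B \<in> \<B> \<Longrightarrow> basic_semialgebraic B" "K = \<Union>\<B>"
    unfolding semialgebraic_def by auto
  have "\<exists>Q. B \<in> \<B> \<longrightarrow> finite Q \<and> Q \<subseteq> Collect real_polynomial_function \<and>
          (\<forall>x y. same_signs Q x y \<longrightarrow> (x \<in> B \<longleftrightarrow> y \<in> B))" for B
  proof (cases "B \<in> \<B>")
    case True
    then obtain H G where HG: "finite H" "finite G" "H \<union> G \<subseteq> Collect real_polynomial_function"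
      "B = {x. (\<forall>h\<in>H. h x = 0) \<and> (\<forall>g\<in>G. g x < 0)}"
      using B(2)[OF True] unfolding basic_semialgebraic_def by auto
    have "x \<in> B \<longleftrightarrow> y \<in> B" if "same_signs (H \<union> G) x y" for x y
    proof -
      have "h x = 0 \<longleftrightarrow> h y = 0" if "h \<in> H" for h
        using that \<open>same_signs (H \<union> G) x y\<close> unfolding same_signs_def by (metis UnI1 sgn_eq_0_iff)
      moreover have "g x < 0 \<longleftrightarrow> g y < 0" if "g \<in> G" for g
        using that \<open>same_signs (H \<union> G) x y\<close> unfolding same_signs_def by (metis UnI2 sgn_less)
      ultimately show ?thesis by (auto simp: HG(4))
    qed
    then show ?thesis using HG by (intro exI[of _ "H \<union> G"]) auto
  qed auto
  then obtain Q where Q: "\<And>B. B \<in> \<B> \<Longrightarrow> finite (Q B)" "\<And>B. B \<in> \<B> \<Longrightarrow> Q B \<subseteq> Collect real_polynomial_function"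
    "\<And>B x y. B \<in> \<B> \<Longrightarrow> same_signs (Q B) x y \<Longrightarrow> (x \<in> B \<longleftrightarrow> y \<in> B)" by metis
  have "x \<in> K \<longleftrightarrow> y \<in> K" if "same_signs (\<Union>(Q ` \<B>)) x y" for x y
  proof -
    have "same_signs (Q B) x y" if "B \<in> \<B>" for B
      using that \<open>same_signs (\<Union>(Q ` \<B>)) x y\<close> unfolding same_signs_def by blast
    then show ?thesis using Q(3) B(3) by blast
  qed
  then show "sign_determined (Collect real_polynomial_function) K"
    unfolding sign_determined_def using B(1) Q by (intro exI[of _ "\<Union>(Q ` \<B>)"]) blast
next
  assume "sign_determined (Collect real_polynomial_function) K"
  then obtain Q where Q: "finite Q" "\<And>q. q \<in> Q \<Longrightarrow> real_polynomial_function q"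
    "\<And>x y. same_signs Q x y \<Longrightarrow> (x \<in> K \<longleftrightarrow> y \<in> K)"
    unfolding sign_determined_def by blast
  define cell where "cell \<sigma> = {x. \<forall>q\<in>Q. sgn (q x) = \<sigma> q}" for \<sigma>
  define sv where "sv x = restrict (\<lambda>q. sgn (q x)) Q" for x
  have cell: "y \<in> cell (sv x) \<longleftrightarrow> same_signs Q x y" for x y
    by (auto simp: cell_def sv_def same_signs_def)
  have sgn_range: "sgn t = -1 \<or> sgn t = 0 \<or> sgn t = 1" for t :: real by (simp add: sgn_if)
  then have "sv x \<in> PiE Q (\<lambda>_. {-1, 0, 1})" for x by (auto simp: sv_def)
  then have "sv ` K \<subseteq> PiE Q (\<lambda>_. {-1, 0, 1})" by blast
  then have "finite (sv ` K)" by (rule finite_subset) (auto intro: finite_PiE Q(1))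
  moreover have "basic_semialgebraic (cell \<sigma>)" if "\<sigma> \<in> sv ` K" for \<sigma>
  proof -
    have s: "\<sigma> q = -1 \<or> \<sigma> q = 0 \<or> \<sigma> q = 1" if "q \<in> Q" for q
    proof -
      obtain x where "\<sigma> = sv x" using \<open>\<sigma> \<in> sv ` K\<close> by blast
      then have "\<sigma> q = sgn (q x)" using that by (simp add: sv_def)
      then show ?thesis using sgn_range[of "q x"] by (simp only:)
    qed
    define H where "H = {q \<in> Q. \<sigma> q = 0}"
    define G where "G = {q \<in> Q. \<sigma> q = -1} \<union> (\<lambda>q x. - q x) ` {q \<in> Q. \<sigma> q = 1}"
    have "real_polynomial_function (\<lambda>x. - q x)" if "q \<in> Q" for q
      using Q(2)[OF that] by (rule real_polynomial_function_minus)
    then have "\<forall>g\<in>G. real_polynomial_function g" "\<forall>h\<in>H. real_polynomial_function h"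
      using Q(2) by (auto simp: G_def H_def)
    moreover have "finite H" "finite G" using Q(1) by (auto simp: G_def H_def)
    moreover have "x \<in> cell \<sigma> \<longleftrightarrow> (\<forall>h\<in>H. h x = 0) \<and> (\<forall>g\<in>G. g x < 0)" for x
    proof
      assume x: "x \<in> cell \<sigma>"
      have "h x = 0" if "h \<in> H" for h using x that by (auto simp: cell_def H_def sgn_eq_0_iff)
      moreover have "q x < 0" if "q \<in> Q" "\<sigma> q = -1" for q
      proof -
        have "sgn (q x) = -1" using x that by (simp add: cell_def)
        then show ?thesis by (simp add: sgn_if split: if_splits)
      qed
      moreover have "q x > 0" if "q \<in> Q" "\<sigma> q = 1" for q
      proof -
        have "sgn (q x) = 1" using x that by (simp add: cell_def)
        then show ?thesis by (simp add: sgn_if split: if_splits)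
      qed
      ultimately show "(\<forall>h\<in>H. h x = 0) \<and> (\<forall>g\<in>G. g x < 0)" by (auto simp: G_def)
    next
      assume x: "(\<forall>h\<in>H. h x = 0) \<and> (\<forall>g\<in>G. g x < 0)"
      have "sgn (q x) = \<sigma> q" if q: "q \<in> Q" for q
        using s[OF q]
      proof (elim disjE)
        assume "\<sigma> q = -1"
        then have "q x < 0" using x q by (auto simp: G_def)
        then show ?thesis using \<open>\<sigma> q = -1\<close> by simp
      next
        assume "\<sigma> q = 0"
        then have "q x = 0" using x q by (auto simp: H_def)
        then show ?thesis using \<open>\<sigma> q = 0\<close> by simp
      next
        assume "\<sigma> q = 1"
        then have "(\<lambda>x. - q x) \<in> G" using q by (auto simp: G_def)
        from bspec[OF conjunct2[OF x] this] have "q x > 0" by simp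
        then show ?thesis using \<open>\<sigma> q = 1\<close> by simp
      qed
      then show "x \<in> cell \<sigma>" by (simp add: cell_def)
    qed
    then have "cell \<sigma> = {x. (\<forall>h\<in>H. h x = 0) \<and> (\<forall>g\<in>G. g x < 0)}" by blast
    ultimately show ?thesis unfolding basic_semialgebraic_def by blast
  qed
  moreover have "K = \<Union>(cell ` sv ` K)"
  proof -
    have "x \<in> cell (sv x)" for x by (simp add: cell same_signs_def)
    moreover have "y \<in> K" if "x \<in> K" "y \<in> cell (sv x)" for x y using that cell Q(3) by blast
    ultimately show ?thesis by blast
  qed
  ultimately show "semialgebraic K"
    unfolding semialgebraic_def by (intro exI[of _ "cell ` sv ` K"]) auto
qed

text \<open>Points are sequences of which only the first \<open>n\<close> entries matter, because the induction on the
  dimension has to compare spaces of different dimension inside one type.\<close>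

inductive_set coord_polys :: "nat \<Rightarrow> ((nat \<Rightarrow> real) \<Rightarrow> real) set" for n where
  const: "(\<lambda>x. c) \<in> coord_polys n"
| coord: "i < n \<Longrightarrow> (\<lambda>x. x i) \<in> coord_polys n"
| add: "p \<in> coord_polys n \<Longrightarrow> q \<in> coord_polys n \<Longrightarrow> (\<lambda>x. p x + q x) \<in> coord_polys n"
| mult: "p \<in> coord_polys n \<Longrightarrow> q \<in> coord_polys n \<Longrightarrow> (\<lambda>x. p x * q x) \<in> coord_polys n"

interpretation coord_polys: function_algebra "coord_polys n" for n
  by unfold_locales (auto intro: coord_polys.intros)

abbreviation coord_param_poly :: "nat \<Rightarrow> nat \<Rightarrow> ((nat \<Rightarrow> real) \<Rightarrow> real poly) \<Rightarrow> bool" where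
  "coord_param_poly n \<equiv> function_algebra.param_poly (coord_polys n)"

lemma coord_polys_cong:
  assumes "p \<in> coord_polys n" and "\<And>i. i < n \<Longrightarrow> x i = y i"
  shows "p x = p y"
  using assms by (induction rule: coord_polys.induct) auto

lemma continuous_on_coord_polys: "p \<in> coord_polys n \<Longrightarrow> continuous_on S p"
proof (rule continuous_on_subset[OF _ subset_UNIV])
  show "p \<in> coord_polys n \<Longrightarrow> continuous_on UNIV p"
    by (induction rule: coord_polys.induct) (auto intro: continuous_intros)
qed

lemma coord_param_poly_cong:
  assumes "coord_param_poly n d F" and "\<And>i. i < n \<Longrightarrow> x i = y i"
  shows "F x = F y"
  using assms coord_polys_cong[of _ n x y] unfolding coord_polys.param_poly_def
  by (auto intro!: poly_eqI)

lemma coord_polys_Suc_as_param_poly: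
  assumes "p \<in> coord_polys (Suc n)"
  shows "\<exists>F d. coord_param_poly n d F \<and> (\<forall>x. p x = poly (F x) (x n))"
  using assms
proof (induction rule: coord_polys.induct)
  case (const c)
  then show ?case using coord_polys.param_poly_const[OF coord_polys.const[of c]] by fastforce
next
  case (coord i)
  show ?case
  proof (cases "i = n")
    case True
    then show ?thesis using coord_polys.param_poly_var by (intro exI[of _ "\<lambda>x. [:0, 1:]"]) auto
  next
    case False
    then have "i < n" using coord by simp
    then show ?thesis using coord_polys.param_poly_const[OF coord_polys.coord] by fastforce
  qed
next
  case (add p q)
  then obtain F d G e where "coord_param_poly n d F" "\<And>x. p x = poly (F x) (x n)"
    "coord_param_poly n e G" "\<And>x. q x = poly (G x) (x n)" by blast
  then show ?case using coord_polys.param_poly_add[of n d F e G] by (intro exI[of _ "\<lambda>x. F x + G x"]) auto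
next
  case (mult p q)
  then obtain F d G e where "coord_param_poly n d F" "\<And>x. p x = poly (F x) (x n)"
    "coord_param_poly n e G" "\<And>x. q x = poly (G x) (x n)" by blast
  then show ?case using coord_polys.param_poly_mult[of n d F e G] by (intro exI[of _ "\<lambda>x. F x * G x"]) auto
qed

lemma coord_polys_family_as_param_polys:
  assumes "P \<subseteq> coord_polys (Suc n)"
  obtains F where "\<And>p. p \<in> P \<Longrightarrow> \<exists>d. coord_param_poly n d (F p)"
    and "\<And>p x y. p \<in> P \<Longrightarrow> p (x(n := y)) = poly (F p x) y"
proof -
  have "\<forall>p\<in>P. \<exists>F. (\<exists>d. coord_param_poly n d F) \<and> (\<forall>x. p x = poly (F x) (x n))"
    using coord_polys_Suc_as_param_poly assms by blast
  then obtain F where F: "\<And>p. p \<in> P \<Longrightarrow> \<exists>d. coord_param_poly n d (F p)"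
    "\<And>p x. p \<in> P \<Longrightarrow> p x = poly (F p x) (x n)" by metis
  have "p (x(n := y)) = poly (F p x) y" if "p \<in> P" for p x y
  proof -
    obtain d where "coord_param_poly n d (F p)" using F(1)[OF \<open>p \<in> P\<close>] by blast
    then have "F p (x(n := y)) = F p x" by (rule coord_param_poly_cong) simp
    then show ?thesis using F(2)[OF that, of "x(n := y)"] by simp
  qed
  then show ?thesis using F(1) that by blast
qed

text \<open>The Tarski-Seidenberg theorem. If \<open>x\<close> and \<open>y\<close> have the same fibrewise sign pattern, the matching
  bijection carries a point of \<open>S\<close> over \<open>x\<close> to a point of \<open>S\<close> over \<open>y\<close>.\<close>

theorem sign_determined_projection:
  assumes "sign_determined (coord_polys (Suc n)) S"
  shows "sign_determined (coord_polys n) {x. \<exists>t. x(n := t) \<in> S}"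
proof -
  obtain P where P: "finite P" "P \<subseteq> coord_polys (Suc n)" "\<And>x y. same_signs P x y \<Longrightarrow> (x \<in> S \<longleftrightarrow> y \<in> S)"
    using assms unfolding sign_determined_def by metis
  obtain F where F: "\<And>p. p \<in> P \<Longrightarrow> \<exists>d. coord_param_poly n d (F p)"
    "\<And>p x y. p \<in> P \<Longrightarrow> p (x(n := y)) = poly (F p x) y"
    using coord_polys_family_as_param_polys[OF P(2)] by metis
  obtain Q where Q: "finite Q" "Q \<subseteq> coord_polys n"
    "\<And>x x'. same_signs Q x x' \<Longrightarrow> \<exists>\<phi>. fibre_sign_iso (F ` P) \<phi> x x'"
    using coord_polys.fibre_sign_iso_exists[of "F ` P" n] P(1) F(1) by blast
  have "\<exists>t. y(n := t) \<in> S" if "same_signs Q x y" and x: "x(n := t) \<in> S" for x y t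
  proof -
    obtain \<phi> where "fibre_sign_iso (F ` P) \<phi> x y" using Q(3)[OF \<open>same_signs Q x y\<close>] by blast
    then have "same_signs P (x(n := t)) (y(n := \<phi> t))"
      unfolding same_signs_def fibre_sign_iso_def by (simp add: F(2))
    then show ?thesis using P(3) x by blast
  qed
  then have "(\<exists>t. x(n := t) \<in> S) \<longleftrightarrow> (\<exists>t. y(n := t) \<in> S)" if "same_signs Q x y" for x y
    using that same_signs_sym[OF that] by (intro iffI; elim exE) metis+
  then show ?thesis unfolding sign_determined_def mem_Collect_eq
    using Q(1,2) by (intro exI[of _ Q] conjI allI impI)
qed

lemma sign_determined_iterated_projection:
  assumes "sign_determined (coord_polys (m + k)) S"
  shows "sign_determined (coord_polys m) {x. \<exists>z. (\<forall>i<m. z i = x i) \<and> z \<in> S}"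
  using assms
proof (induction k arbitrary: S)
  case 0
  then obtain Q where Q: "finite Q" "Q \<subseteq> coord_polys m" "\<And>x y. same_signs Q x y \<Longrightarrow> (x \<in> S \<longleftrightarrow> y \<in> S)"
    unfolding sign_determined_def by auto
  have "same_signs Q z x" if "\<forall>i<m. z i = x i" for z x
    using that coord_polys_cong[of _ m z x] Q(2) unfolding same_signs_def by (metis subsetD)
  then have "{x. \<exists>z. (\<forall>i<m. z i = x i) \<and> z \<in> S} = S" using Q(3) by blast
  then show ?case using 0 by simp
next
  case (Suc k)
  have "sign_determined (coord_polys (m + k)) {x. \<exists>t. x(m + k := t) \<in> S}"
    using Suc.prems by (intro sign_determined_projection) simp
  from Suc.IH[OF this]
  have "sign_determined (coord_polys m) {x. \<exists>z. (\<forall>i<m. z i = x i) \<and> (\<exists>t. z(m + k := t) \<in> S)}"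
    unfolding mem_Collect_eq .
  also have "{x. \<exists>z. (\<forall>i<m. z i = x i) \<and> (\<exists>t. z(m + k := t) \<in> S)} = {x. \<exists>z. (\<forall>i<m. z i = x i) \<and> z \<in> S}"
  proof (intro Collect_cong iffI; elim exE conjE)
    fix x z t assume "\<forall>i<m. z i = x i" "z(m + k := t) \<in> S"
    then show "\<exists>z. (\<forall>i<m. z i = x i) \<and> z \<in> S" by (intro exI[of _ "z(m + k := t)"]) auto
  next
    fix x z assume z: "\<forall>i<m. z i = x i" "z \<in> S"
    then show "\<exists>z. (\<forall>i<m. z i = x i) \<and> (\<exists>t. z(m + k := t) \<in> S)"
      by (intro exI[of _ z] conjI exI[of _ "z (m + k)"]) simp_all
  qed
  finally show ?case .
qed

section \<open>Continuity of the ordered roots\<close>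

text \<open>Indices start at \<open>0\<close>; the value is meaningful for \<open>j < card Z\<close>.\<close>

definition nth_least :: "real set \<Rightarrow> nat \<Rightarrow> real" where
  "nth_least Z j = (SOME z. z \<in> Z \<and> card (Z \<inter> {..<z}) = j)"

lemma card_below_strict_mono:
  fixes Z :: "real set"
  assumes "finite Z" "z \<in> Z" "z < t"
  shows "card (Z \<inter> {..<z}) < card (Z \<inter> {..<t})"
  by (rule psubset_card_mono) (use assms in auto)

lemma nth_least:
  fixes Z :: "real set"
  assumes "finite Z" "j < card Z"
  shows "nth_least Z j \<in> Z" "card (Z \<inter> {..<nth_least Z j}) = j"
proof -
  define r where "r z = card (Z \<inter> {..<z})" for z
  have mono: "r y < r z" if "y \<in> Z" "y < z" for y z
    unfolding r_def using card_below_strict_mono[OF assms(1) that] .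
  have "inj_on r Z"
    by (rule linorder_inj_onI') (use mono in fastforce)
  then have "card (r ` Z) = card Z" by (rule card_image)
  moreover have "r z < card Z" if "z \<in> Z" for z
    unfolding r_def using assms(1) that by (intro psubset_card_mono) auto
  then have "r ` Z \<subseteq> {..<card Z}" by blast
  ultimately have "r ` Z = {..<card Z}" by (intro card_subset_eq) auto
  then have "j \<in> r ` Z" using assms(2) by simp
  then have "\<exists>z. z \<in> Z \<and> card (Z \<inter> {..<z}) = j" unfolding r_def by blast
  then have "nth_least Z j \<in> Z \<and> card (Z \<inter> {..<nth_least Z j}) = j"
    unfolding nth_least_def by (rule someI_ex)
  then show "nth_least Z j \<in> Z" "card (Z \<inter> {..<nth_least Z j}) = j" by auto
qed

lemma nth_least_less_iff:
  fixes Z :: "real set"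
  assumes "finite Z" "j < card Z"
  shows "nth_least Z j < c \<longleftrightarrow> j < card (Z \<inter> {..<c})"
proof
  assume "nth_least Z j < c"
  then show "j < card (Z \<inter> {..<c})"
    using card_below_strict_mono[OF assms(1) nth_least(1)[OF assms]] nth_least(2)[OF assms] by metis
next
  assume j: "j < card (Z \<inter> {..<c})"
  show "nth_least Z j < c"
  proof (rule ccontr)
    assume "\<not> nth_least Z j < c"
    then have "card (Z \<inter> {..<c}) \<le> card (Z \<inter> {..<nth_least Z j})"
      using assms(1) by (intro card_mono) auto
    then show False using j nth_least(2)[OF assms] by simp
  qed
qed

lemma less_nth_least_iff:
  fixes Z :: "real set"
  assumes "finite Z" "j < card Z"
  shows "c < nth_least Z j \<longleftrightarrow> card Z - j \<le> card (Z \<inter> {c<..})"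
proof -
  have split: "card Z = card (Z \<inter> {..c}) + card (Z \<inter> {c<..})"
  proof -
    have "card Z = card ((Z \<inter> {..c}) \<union> (Z \<inter> {c<..}))" by (rule arg_cong[where f = card]) auto
    also have "\<dots> = card (Z \<inter> {..c}) + card (Z \<inter> {c<..})"
      by (rule card_Un_disjoint) (use assms(1) in auto)
    finally show ?thesis .
  qed
  have "c < nth_least Z j \<longleftrightarrow> card (Z \<inter> {..c}) \<le> j"
  proof
    assume "c < nth_least Z j"
    then have "card (Z \<inter> {..c}) \<le> card (Z \<inter> {..<nth_least Z j})"
      using assms(1) by (intro card_mono) auto
    then show "card (Z \<inter> {..c}) \<le> j" using nth_least(2)[OF assms] by simp
  next
    assume *: "card (Z \<inter> {..c}) \<le> j"
    show "c < nth_least Z j"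
    proof (rule ccontr)
      assume "\<not> c < nth_least Z j"
      then have "insert (nth_least Z j) (Z \<inter> {..<nth_least Z j}) \<subseteq> Z \<inter> {..c}"
        using nth_least(1)[OF assms] by auto
      then have "card (insert (nth_least Z j) (Z \<inter> {..<nth_least Z j})) \<le> card (Z \<inter> {..c})"
        by (rule card_mono[rotated]) (simp add: assms(1))
      then have "Suc j \<le> card (Z \<inter> {..c})"
        using nth_least(2)[OF assms] assms(1) by simp
      then show False using * by simp
    qed
  qed
  also have "\<dots> \<longleftrightarrow> card Z - j \<le> card (Z \<inter> {c<..})"
    unfolding split by (rule iffI) simp_all
  finally show ?thesis .
qed

text \<open>The premises about \<open>nth_least\<close> are conditional in order to cover the two unbounded gaps.\<close>

lemma rank_between_nth_least:
  fixes Z :: "real set"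
  assumes Z: "finite Z" "j \<le> card Z"
    and lo: "0 < j \<Longrightarrow> nth_least Z (j - 1) < t" and hi: "j < card Z \<Longrightarrow> t < nth_least Z j"
  shows "t \<notin> Z" "card (Z \<inter> {..<t}) = j"
proof -
  have a: "j \<le> card (Z \<inter> {..<t})"
    using nth_least_less_iff[OF Z(1), of "j - 1" t] lo Z(2) by (cases j) auto
  have b: "card (Z \<inter> {..t}) \<le> j"
  proof (cases "j < card Z")
    case True
    then have "card (Z \<inter> {..t}) \<le> card (Z \<inter> {..<nth_least Z j})"
      using Z(1) hi by (intro card_mono) auto
    then show ?thesis using nth_least(2)[OF Z(1) True] by simp
  next
    case False
    then show ?thesis using Z card_mono[of Z "Z \<inter> {..t}"] by auto
  qed
  have c: "card (Z \<inter> {..<t}) \<le> card (Z \<inter> {..t})" using Z(1) by (intro card_mono) auto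
  show "card (Z \<inter> {..<t}) = j" using a b c by simp
  show "t \<notin> Z"
  proof
    assume "t \<in> Z"
    then have "card (Z \<inter> {..<t}) < card (Z \<inter> {..t})"
      using Z(1) by (intro psubset_card_mono) auto
    then show False using a b by simp
  qed
qed

lemma eq_of_rank_eq:
  fixes Z :: "real set"
  assumes "finite Z" "s \<in> Z" "t \<in> Z" "card (Z \<inter> {..<s}) = card (Z \<inter> {..<t})"
  shows "s = t"
  using assms card_below_strict_mono[of Z s t] card_below_strict_mono[of Z t s]
  by (cases s t rule: linorder_cases) auto

lemma rank_eq_imp_gap:
  fixes Z :: "real set"
  assumes Z: "finite Z" and "s \<notin> Z" "t \<notin> Z" and r: "card (Z \<inter> {..<s}) = card (Z \<inter> {..<t})"
    and u: "min s t \<le> u" "u \<le> max s t"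
  shows "u \<notin> Z" "card (Z \<inter> {..<u}) = card (Z \<inter> {..<s})"
proof -
  define a b where "a = min s t" and "b = max s t"
  have ab: "a \<le> u" "u \<le> b" "b \<notin> Z" "card (Z \<inter> {..<a}) = card (Z \<inter> {..<s})" "card (Z \<inter> {..<b}) = card (Z \<inter> {..<s})"
    using assms by (auto simp: a_def b_def min_def max_def)
  have 1: "card (Z \<inter> {..<a}) \<le> card (Z \<inter> {..<u})" using Z ab by (intro card_mono) auto
  have 2: "card (Z \<inter> {..<u}) \<le> card (Z \<inter> {..<b})" using Z ab by (intro card_mono) auto
  show "card (Z \<inter> {..<u}) = card (Z \<inter> {..<s})" using 1 2 ab by simp
  show "u \<notin> Z"
  proof
    assume "u \<in> Z"
    then have "u < b" using ab by (cases "u = b") auto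
    then show False using card_below_strict_mono[OF Z \<open>u \<in> Z\<close>] 1 ab by fastforce
  qed
qed

text \<open>Differentiating one time less than the multiplicity of the root \<open>z\<close> turns it into a simple root, at
  which the sign changes.\<close>

lemma sign_change_of_iterated_pderiv:
  fixes p :: "real poly"
  assumes "p \<noteq> 0" "poly p z = 0" "w > 0"
  shows "\<exists>k u v. z - w < u \<and> u < v \<and> v < z + w \<and>
                 poly ((pderiv ^^ k) p) u * poly ((pderiv ^^ k) p) v < 0"
  using assms
proof (induction "degree p" arbitrary: p rule: less_induct)
  case less
  have "degree p \<noteq> 0"
  proof
    assume "degree p = 0"
    then obtain c where "p = [:c:]" by (rule degree_eq_zeroE)
    then show False using less.prems by simp
  qed
  show ?case
  proof (cases "poly (pderiv p) z = 0")
    case True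
    have "pderiv p \<noteq> 0" "degree (pderiv p) < degree p"
      using \<open>degree p \<noteq> 0\<close> by (auto simp: pderiv_eq_0_iff degree_pderiv)
    then obtain k u v where "z - w < u" "u < v" "v < z + w"
      "poly ((pderiv ^^ k) (pderiv p)) u * poly ((pderiv ^^ k) (pderiv p)) v < 0"
      using less.hyps[of "pderiv p"] True less.prems(3) by blast
    then show ?thesis
      by (intro exI[of _ "Suc k"] exI[of _ u] exI[of _ v]) (simp add: funpow_swap1)
  next
    case False
    have D: "DERIV (poly p) z :> poly (pderiv p) z" by (rule poly_DERIV)
    have "\<exists>d>0. \<forall>h>0. h < d \<longrightarrow> poly p (z - h) * poly p (z + h) < 0"
    proof (cases "poly (pderiv p) z > 0")
      case True
      obtain d e where "d > 0" "e > 0" "\<And>h. h > 0 \<Longrightarrow> h < d \<Longrightarrow> poly p z < poly p (z + h)"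
        "\<And>h. h > 0 \<Longrightarrow> h < e \<Longrightarrow> poly p (z - h) < poly p z"
        using DERIV_pos_inc_right[OF D True] DERIV_pos_inc_left[OF D True] by auto
      then show ?thesis using less.prems(2)
        by (intro exI[of _ "min d e"]) (auto simp: mult_less_0_iff)
    next
      case False
      then have neg: "poly (pderiv p) z < 0" using \<open>poly (pderiv p) z \<noteq> 0\<close> by simp
      obtain d e where "d > 0" "e > 0" "\<And>h. h > 0 \<Longrightarrow> h < d \<Longrightarrow> poly p z > poly p (z + h)"
        "\<And>h. h > 0 \<Longrightarrow> h < e \<Longrightarrow> poly p (z - h) > poly p z"
        using DERIV_neg_dec_right[OF D neg] DERIV_neg_dec_left[OF D neg] by auto
      then show ?thesis using less.prems(2)
        by (intro exI[of _ "min d e"]) (auto simp: mult_less_0_iff)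
    qed
    then obtain d where d: "d > 0" "\<And>h. h > 0 \<Longrightarrow> h < d \<Longrightarrow> poly p (z - h) * poly p (z + h) < 0" by auto
    define h where "h = min d w / 2"
    have "h > 0" "h < d" "h < w" using d(1) less.prems(3) by (auto simp: h_def)
    then show ?thesis using d(2)[of h]
      by (intro exI[of _ 0] exI[of _ "z - h"] exI[of _ "z + h"]) auto
  qed
qed

definition fibre_roots :: "('a \<Rightarrow> real poly) set \<Rightarrow> 'a \<Rightarrow> real set" where
  "fibre_roots \<F> x = {y. \<exists>F\<in>\<F>. F x \<noteq> 0 \<and> poly (F x) y = 0}"

lemma finite_fibre_roots: "finite \<F> \<Longrightarrow> finite (fibre_roots \<F> x)"
proof -
  assume "finite \<F>"
  have "finite {y. F x \<noteq> 0 \<and> poly (F x) y = 0}" for F :: "'a \<Rightarrow> real poly"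
    by (cases "F x = 0") (auto simp: poly_roots_finite)
  then have "finite (\<Union>F\<in>\<F>. {y. F x \<noteq> 0 \<and> poly (F x) y = 0})" using \<open>finite \<F>\<close> by blast
  then show ?thesis by (rule finite_subset[rotated]) (auto simp: fibre_roots_def)
qed

lemma fibre_sign_iso_roots:
  assumes "fibre_sign_iso \<F> \<phi> x x'"
  shows "fibre_roots \<F> x' = \<phi> ` fibre_roots \<F> x"
proof -
  have phi: "order_iso \<phi>" and sg: "\<And>F y. F \<in> \<F> \<Longrightarrow> sgn (poly (F x') (\<phi> y)) = sgn (poly (F x) y)"
    using assms by (auto simp: fibre_sign_iso_def)
  have r: "poly (F x') (\<phi> y) = 0 \<longleftrightarrow> poly (F x) y = 0" if "F \<in> \<F>" for F y
    using sg[OF that, of y] by (metis sgn_eq_0_iff)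
  have surj: "\<exists>y. u = \<phi> y" for u using phi by (metis surjD)
  have z: "F x' = 0 \<longleftrightarrow> F x = 0" if "F \<in> \<F>" for F
  proof -
    have "F x' = 0 \<longleftrightarrow> (\<forall>u. poly (F x') u = 0)" by (simp add: poly_all_0_iff_0)
    also have "\<dots> \<longleftrightarrow> (\<forall>y. poly (F x') (\<phi> y) = 0)"
    proof (intro iffI allI)
      fix u assume *: "\<forall>y. poly (F x') (\<phi> y) = 0"
      obtain y where "u = \<phi> y" using surj[of u] ..
      then show "poly (F x') u = 0" using * by simp
    qed simp
    also have "\<dots> \<longleftrightarrow> F x = 0" by (simp add: r[OF that] poly_all_0_iff_0)
    finally show ?thesis .
  qed
  have "\<phi> y \<in> fibre_roots \<F> x' \<longleftrightarrow> y \<in> fibre_roots \<F> x" for y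
    unfolding fibre_roots_def mem_Collect_eq using r z by (intro bex_cong refl) simp
  then have "fibre_roots \<F> x = \<phi> -` fibre_roots \<F> x'" by auto
  moreover have "\<phi> ` (\<phi> -` fibre_roots \<F> x') = fibre_roots \<F> x'"
    using phi by (intro surj_image_vimage_eq) simp
  ultimately show ?thesis by simp
qed

lemma (in function_algebra) poly_param_poly_mem:
  assumes "param_poly d F"
  shows "(\<lambda>x. poly (F x) u) \<in> A"
proof -
  have "poly (F x) u = (\<Sum>i<d. coeff (F x) i * u ^ i)" for x
  proof -
    have "(\<Sum>i\<le>degree (F x). coeff (F x) i * u ^ i) = (\<Sum>i\<in>{..degree (F x)} \<inter> {..<d}. coeff (F x) i * u ^ i)"
      using assms unfolding param_poly_def by (intro sum.mono_neutral_right) auto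
    also have "\<dots> = (\<Sum>i<d. coeff (F x) i * u ^ i)"
      by (intro sum.mono_neutral_left) (auto simp: coeff_eq_0)
    finally show ?thesis by (simp add: poly_altdef)
  qed
  then show ?thesis using assms unfolding param_poly_def by (auto intro!: sum_mem mult_mem const_mem)
qed

text \<open>A sign change of a derivative between two fixed heights is an open condition on the parameter. This
  is where closure of the family under differentiation enters: a root of even multiplicity of \<open>F\<close>
  may disappear under perturbation, but it is also a simple root of a member of the family.\<close>

lemma fibre_root_persists:
  assumes F: "\<And>F. F \<in> \<F> \<Longrightarrow> \<exists>d. coord_param_poly n d F" "\<And>F. F \<in> \<F> \<Longrightarrow> (\<lambda>x. pderiv (F x)) \<in> \<F>"
    and z: "z \<in> fibre_roots \<F> x0" and "w > 0"
  shows "\<exists>V. open V \<and> x0 \<in> V \<and> (\<forall>x\<in>V. \<exists>y\<in>fibre_roots \<F> x. \<bar>y - z\<bar> < w)"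
proof -
  obtain F where Fz: "F \<in> \<F>" "F x0 \<noteq> 0" "poly (F x0) z = 0" using z by (auto simp: fibre_roots_def)
  obtain k u v where uv: "z - w < u" "u < v" "v < z + w"
    "poly ((pderiv ^^ k) (F x0)) u * poly ((pderiv ^^ k) (F x0)) v < 0"
    using sign_change_of_iterated_pderiv[OF Fz(2,3) \<open>w > 0\<close>] by blast
  define G where "G x = (pderiv ^^ k) (F x)" for x
  have "(\<lambda>x. (pderiv ^^ k) (F x)) \<in> \<F>" by (induction k) (use Fz(1) F(2) in auto)
  then have G: "G \<in> \<F>" by (simp add: G_def[abs_def])
  then obtain d where "coord_param_poly n d G" using F(1) by blast
  then have "continuous_on UNIV (\<lambda>x. poly (G x) u * poly (G x) v)"
    by (intro continuous_on_mult continuous_on_coord_polys coord_polys.poly_param_poly_mem)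
  then have "open {x. poly (G x) u * poly (G x) v < 0}"
    by (intro open_Collect_less) auto
  moreover have "\<exists>y\<in>fibre_roots \<F> x. \<bar>y - z\<bar> < w" if x: "poly (G x) u * poly (G x) v < 0" for x
  proof -
    obtain y where y: "u < y" "y < v" "poly (G x) y = 0" using poly_IVT[OF uv(2) x] by blast
    have "G x \<noteq> 0" using x by auto
    then have "y \<in> fibre_roots \<F> x" using G y by (auto simp: fibre_roots_def)
    then show ?thesis using y uv by (intro bexI[of _ y]) auto
  qed
  ultimately show ?thesis using uv(4)
    by (intro exI[of _ "{x. poly (G x) u * poly (G x) v < 0}"]) (auto simp: G_def)
qed

text \<open>The roots over \<open>x0\<close> in \<open>U\<close> have disjoint neighbourhoods inside \<open>U\<close>, each of which retains a root.\<close>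

lemma card_fibre_roots_lower_semicontinuous:
  assumes "finite \<F>"
    and F: "\<And>F. F \<in> \<F> \<Longrightarrow> \<exists>d. coord_param_poly n d F" "\<And>F. F \<in> \<F> \<Longrightarrow> (\<lambda>x. pderiv (F x)) \<in> \<F>"
    and "open U"
  shows "\<exists>V. open V \<and> x0 \<in> V \<and> (\<forall>x\<in>V. card (fibre_roots \<F> x0 \<inter> U) \<le> card (fibre_roots \<F> x \<inter> U))"
proof -
  define Z where "Z = fibre_roots \<F> x0 \<inter> U"
  have finZ: "finite Z" using finite_fibre_roots[OF assms(1)] by (simp add: Z_def)
  \<comment> \<open>Half the minimal distance between roots separates them; the element \<open>1\<close> covers the case of fewer
    than two roots.\<close>
  define D where "D = insert 1 ((\<lambda>(y, z). \<bar>y - z\<bar>) ` {(y, z) \<in> Z \<times> Z. y \<noteq> z})"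
  have finD: "finite D" unfolding D_def
    by (intro finite.insertI finite_imageI finite_subset[OF _ finite_cartesian_product[OF finZ finZ]]) auto
  define d where "d = Min D"
  have "d \<in> D" unfolding d_def using finD by (intro Min_in) (auto simp: D_def)
  then have "d > 0" by (auto simp: D_def)
  have dle: "d \<le> \<bar>y - z\<bar>" if "y \<in> Z" "z \<in> Z" "y \<noteq> z" for y z
    unfolding d_def using finD that by (intro Min_le) (auto simp: D_def intro!: image_eqI[of _ _ "(y, z)"])
  have "\<exists>V. z \<in> Z \<longrightarrow> open V \<and> x0 \<in> V \<and> (\<forall>x\<in>V. \<exists>y\<in>fibre_roots \<F> x. \<bar>y - z\<bar> < d / 2 \<and> y \<in> U)" for z
  proof (cases "z \<in> Z")
    case True
    then obtain r where r: "r > 0" "ball z r \<subseteq> U" using \<open>open U\<close> unfolding Z_def open_contains_ball by blast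
    have "min r (d / 2) > 0" using r \<open>d > 0\<close> by simp
    moreover have "z \<in> fibre_roots \<F> x0" using True by (simp add: Z_def)
    ultimately have "\<exists>V. open V \<and> x0 \<in> V \<and> (\<forall>x\<in>V. \<exists>y\<in>fibre_roots \<F> x. \<bar>y - z\<bar> < min r (d / 2))"
      by (intro fibre_root_persists[OF F])
    then obtain V where V: "open V" "x0 \<in> V" "\<And>x. x \<in> V \<Longrightarrow> \<exists>y\<in>fibre_roots \<F> x. \<bar>y - z\<bar> < min r (d / 2)"
      by blast
    have "\<exists>y\<in>fibre_roots \<F> x. \<bar>y - z\<bar> < d / 2 \<and> y \<in> U" if x: "x \<in> V" for x
    proof -
      obtain y where y: "y \<in> fibre_roots \<F> x" "\<bar>y - z\<bar> < min r (d / 2)" using V(3)[OF x] by blast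
      then have "y \<in> ball z r" by (simp add: dist_real_def abs_minus_commute[of z])
      then have "y \<in> U" using r(2) by blast
      then show ?thesis using y by (intro bexI[of _ y]) simp_all
    qed
    then show ?thesis using V by blast
  qed auto
  then have "\<forall>z. \<exists>V. z \<in> Z \<longrightarrow> open V \<and> x0 \<in> V \<and>
      (\<forall>x\<in>V. \<exists>y\<in>fibre_roots \<F> x. \<bar>y - z\<bar> < d / 2 \<and> y \<in> U)" by blast
  from choice[OF this] obtain V where V: "\<And>z. z \<in> Z \<Longrightarrow> open (V z)" "\<And>z. z \<in> Z \<Longrightarrow> x0 \<in> V z"
    "\<And>z x. z \<in> Z \<Longrightarrow> x \<in> V z \<Longrightarrow> \<exists>y\<in>fibre_roots \<F> x. \<bar>y - z\<bar> < d / 2 \<and> y \<in> U" by blast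
  have "card Z \<le> card (fibre_roots \<F> x \<inter> U)" if x: "x \<in> (\<Inter>z\<in>Z. V z)" for x
  proof -
    have "\<forall>z\<in>Z. \<exists>y. y \<in> fibre_roots \<F> x \<and> \<bar>y - z\<bar> < d / 2 \<and> y \<in> U"
      using V(3) x by blast
    from bchoice[OF this] obtain g where
      g: "\<And>z. z \<in> Z \<Longrightarrow> g z \<in> fibre_roots \<F> x \<and> \<bar>g z - z\<bar> < d / 2 \<and> g z \<in> U"
      by blast
    have "inj_on g Z"
    proof (rule inj_onI, rule ccontr)
      fix y z assume yz: "y \<in> Z" "z \<in> Z" "g y = g z" "y \<noteq> z"
      then have "\<bar>g z - y\<bar> < d / 2" "\<bar>g z - z\<bar> < d / 2" "d \<le> \<bar>y - z\<bar>" using g[of y] g[of z] dle by auto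
      then show False by linarith
    qed
    moreover have "g ` Z \<subseteq> fibre_roots \<F> x \<inter> U" using g by blast
    moreover have "finite (fibre_roots \<F> x \<inter> U)" using finite_fibre_roots[OF assms(1)] by blast
    ultimately show ?thesis by (rule card_inj_on_le)
  qed
  moreover have "open (\<Inter>z\<in>Z. V z)" by (rule open_INT[OF finZ]) (simp add: V(1))
  moreover have "x0 \<in> (\<Inter>z\<in>Z. V z)" using V(2) by simp
  ultimately show ?thesis unfolding Z_def[symmetric]
    by (intro exI[of _ "\<Inter>z\<in>Z. V z"] conjI ballI)
qed

text \<open>That the \<open>j\<close>-th root lies below \<open>c\<close> means that more than \<open>j\<close> roots do; that it lies above \<open>c\<close> means,
  the total number \<open>k\<close> being constant, that at least \<open>k - j\<close> roots do. Both conditions are open by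
  semicontinuity.\<close>

lemma continuous_on_nth_fibre_root:
  assumes "finite \<F>"
    and F: "\<And>F. F \<in> \<F> \<Longrightarrow> \<exists>d. coord_param_poly n d F" "\<And>F. F \<in> \<F> \<Longrightarrow> (\<lambda>x. pderiv (F x)) \<in> \<F>"
    and card: "\<And>x. x \<in> S \<Longrightarrow> card (fibre_roots \<F> x) = k" and "j < k"
  shows "continuous_on S (\<lambda>x. nth_least (fibre_roots \<F> x) j)"
  unfolding continuous_on_def
proof (rule ballI, rule order_tendstoI)
  fix x0 c assume x0: "x0 \<in> S" and c: "c < nth_least (fibre_roots \<F> x0) j"
  note fin = finite_fibre_roots[OF assms(1)]
  obtain V where V: "open V" "x0 \<in> V"
    "\<And>x. x \<in> V \<Longrightarrow> card (fibre_roots \<F> x0 \<inter> {c<..}) \<le> card (fibre_roots \<F> x \<inter> {c<..})"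
    using card_fibre_roots_lower_semicontinuous[OF assms(1) F open_greaterThan, of x0 c] by blast
  have "c < nth_least (fibre_roots \<F> x) j" if "x \<in> V" "x \<in> S" for x
  proof -
    have "k - j \<le> card (fibre_roots \<F> x0 \<inter> {c<..})"
      using less_nth_least_iff[OF fin, of j x0 c] card[OF x0] c \<open>j < k\<close> by simp
    then have "k - j \<le> card (fibre_roots \<F> x \<inter> {c<..})" using V(3)[OF that(1)] by linarith
    then show ?thesis
      using less_nth_least_iff[OF fin, of j x c] card[OF that(2)] \<open>j < k\<close> by simp
  qed
  then show "eventually (\<lambda>x. c < nth_least (fibre_roots \<F> x) j) (at x0 within S)"
    using V unfolding eventually_at_topological by blast
next
  fix x0 c assume x0: "x0 \<in> S" and c: "nth_least (fibre_roots \<F> x0) j < c"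
  note fin = finite_fibre_roots[OF assms(1)]
  obtain V where V: "open V" "x0 \<in> V"
    "\<And>x. x \<in> V \<Longrightarrow> card (fibre_roots \<F> x0 \<inter> {..<c}) \<le> card (fibre_roots \<F> x \<inter> {..<c})"
    using card_fibre_roots_lower_semicontinuous[OF assms(1) F open_lessThan, of x0 c] by blast
  have "nth_least (fibre_roots \<F> x) j < c" if "x \<in> V" "x \<in> S" for x
  proof -
    have "j < card (fibre_roots \<F> x0 \<inter> {..<c})"
      using nth_least_less_iff[OF fin, of j x0 c] card[OF x0] c \<open>j < k\<close> by simp
    then have "j < card (fibre_roots \<F> x \<inter> {..<c})" using V(3)[OF that(1)] by linarith
    then show ?thesis
      using nth_least_less_iff[OF fin, of j x c] card[OF that(2)] \<open>j < k\<close> by simp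
  qed
  then show "eventually (\<lambda>x. nth_least (fibre_roots \<F> x) j < c) (at x0 within S)"
    using V unfolding eventually_at_topological by blast
qed

section \<open>Cylindrical decomposition\<close>

definition cylinder :: "nat \<Rightarrow> (nat \<Rightarrow> real) set \<Rightarrow> bool" where
  "cylinder n C \<longleftrightarrow> (\<forall>x y. (\<forall>i<n. x i = y i) \<longrightarrow> x \<in> C \<longrightarrow> y \<in> C)"

text \<open>For small \<open>t > 0\<close> either no point of \<open>C\<close> has first coordinate \<open>t\<close>, or all these slices are met by one
  continuous curve. The construction of cells preserves this property, and it replaces the curve
  selection lemma.\<close>

definition curve_cell :: "(nat \<Rightarrow> real) set \<Rightarrow> bool" where
  "curve_cell C \<longleftrightarrow> (\<exists>e>0. (\<forall>x\<in>C. \<not> (0 < x 0 \<and> x 0 < e)) \<or>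
     (\<exists>\<gamma>. continuous_on {0<..<e} \<gamma> \<and> (\<forall>t\<in>{0<..<e}. \<gamma> t \<in> C \<and> \<gamma> t 0 = t)))"

lemma continuous_on_fun_upd:
  fixes f :: "'a::topological_space \<Rightarrow> nat \<Rightarrow> real"
  assumes "continuous_on S f" "continuous_on S g"
  shows "continuous_on S (\<lambda>x. (f x)(n := g x))"
proof (rule continuous_on_coordinatewise_then_product)
  fix i
  have "continuous_on S (\<lambda>x. f x i)"
    using assms(1) by (rule continuous_on_product_then_coordinatewise)
  then show "continuous_on S (\<lambda>x. ((f x)(n := g x)) i)"
    using assms(2) by (cases "i = n") simp_all
qed

text \<open>Every point of \<open>C\<close> is joined vertically to the section, and the section is a continuous image of
  \<open>S\<close>.\<close>

lemma path_connected_over_section: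
  fixes S C :: "(nat \<Rightarrow> real) set"
  assumes S: "path_connected S" and CS: "C \<subseteq> S"
    and \<sigma>: "continuous_on S \<sigma>" "\<And>x. x \<in> S \<Longrightarrow> x(n := \<sigma> x) \<in> C"
    and conv: "\<And>x s u. x(n := s) \<in> C \<Longrightarrow> x(n := u) \<in> C \<Longrightarrow> closed_segment s u \<subseteq> {t. x(n := t) \<in> C}"
  shows "path_connected C"
proof -
  define g where "g x = x(n := \<sigma> x)" for x
  have "continuous_on S g" unfolding g_def by (intro continuous_on_fun_upd \<sigma> continuous_on_id)
  then have "path_connected (g ` S)" using S by (rule path_connected_continuous_image)
  then have gS: "path_component C (g x) (g y)" if "x \<in> S" "y \<in> S" for x y
    using that \<sigma>(2) path_component_of_subset[of "g ` S" C]
    unfolding path_connected_component g_def by blast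
  have vert: "path_component C x (g x)" if x: "x \<in> C" for x
  proof -
    define h where "h t = x(n := t)" for t
    have seg: "closed_segment (x n) (\<sigma> x) \<subseteq> {t. h t \<in> C}"
      unfolding h_def using x CS \<sigma>(2)[of x] by (intro conv) auto
    have "continuous_on (closed_segment (x n) (\<sigma> x)) h"
      unfolding h_def by (intro continuous_on_fun_upd continuous_on_const continuous_on_id)
    then have "path_connected (h ` closed_segment (x n) (\<sigma> x))"
      by (rule path_connected_continuous_image) (simp add: convex_imp_path_connected)
    then have "path_component (h ` closed_segment (x n) (\<sigma> x)) (h (x n)) (h (\<sigma> x))"
      unfolding path_connected_component by blast
    then have "path_component C (h (x n)) (h (\<sigma> x))"
      using seg by (elim path_component_of_subset[rotated]) blast
    then show ?thesis by (simp add: h_def g_def)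
  qed
  show ?thesis unfolding path_connected_component
  proof (intro ballI)
    fix x y assume "x \<in> C" "y \<in> C"
    then show "path_component C x y"
      using vert gS CS by (meson path_component_sym path_component_trans subsetD)
  qed
qed

lemma curve_cell_over_section:
  assumes S: "curve_cell S" and CS: "C \<subseteq> S" and "n > 0"
    and \<sigma>: "continuous_on S \<sigma>" "\<And>x. x \<in> S \<Longrightarrow> x(n := \<sigma> x) \<in> C"
  shows "curve_cell C"
proof -
  obtain e where e: "e > 0" "(\<forall>x\<in>S. \<not> (0 < x 0 \<and> x 0 < e)) \<or>
     (\<exists>\<gamma>. continuous_on {0<..<e} \<gamma> \<and> (\<forall>t\<in>{0<..<e}. \<gamma> t \<in> S \<and> \<gamma> t 0 = t))"
    using S unfolding curve_cell_def by blast
  from e(2) show ?thesis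
  proof
    assume "\<forall>x\<in>S. \<not> (0 < x 0 \<and> x 0 < e)"
    then show ?thesis using e(1) CS unfolding curve_cell_def by blast
  next
    assume "\<exists>\<gamma>. continuous_on {0<..<e} \<gamma> \<and> (\<forall>t\<in>{0<..<e}. \<gamma> t \<in> S \<and> \<gamma> t 0 = t)"
    then obtain \<gamma> where \<gamma>: "continuous_on {0<..<e} \<gamma>" "\<And>t. t \<in> {0<..<e} \<Longrightarrow> \<gamma> t \<in> S \<and> \<gamma> t 0 = t" by blast
    have "continuous_on {0<..<e} (\<lambda>t. (\<gamma> t)(n := \<sigma> (\<gamma> t)))"
      by (intro continuous_on_fun_upd \<gamma>(1) continuous_on_compose2[OF \<sigma>(1) \<gamma>(1)]) (use \<gamma>(2) in blast)
    moreover have "\<forall>t\<in>{0<..<e}. (\<gamma> t)(n := \<sigma> (\<gamma> t)) \<in> C \<and> ((\<gamma> t)(n := \<sigma> (\<gamma> t))) 0 = t"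
      using \<gamma>(2) \<sigma>(2) \<open>n > 0\<close> by simp
    ultimately show ?thesis unfolding curve_cell_def using e(1)
      by (intro exI[of _ e] conjI disjI2 exI[of _ "\<lambda>t. (\<gamma> t)(n := \<sigma> (\<gamma> t))"])
  qed
qed

text \<open>The first coordinates of a connected \<open>C\<close> form an interval. If it contains arbitrarily small
  positive numbers, it contains all small ones, and \<open>C\<close> ignores the other coordinates.\<close>

lemma curve_cell_of_dimension_one:
  assumes C: "cylinder 1 C" and pc: "path_connected C"
  shows "curve_cell C"
proof (cases "\<exists>e>0. \<forall>x\<in>C. \<not> (0 < x 0 \<and> x 0 < e)")
  case True
  then show ?thesis unfolding curve_cell_def by blast
next
  case False
  then have small: "\<exists>x\<in>C. 0 < x 0 \<and> x 0 < e" if "e > 0" for e using that by blast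
  define I where "I = (\<lambda>x. x 0) ` C"
  have "continuous_on C (\<lambda>x::nat \<Rightarrow> real. x 0)"
    by (rule continuous_on_subset[OF continuous_on_product_coordinates]) simp
  then have "connected I"
    unfolding I_def using pc by (intro connected_continuous_image path_connected_imp_connected)
  obtain x1 where x1: "x1 \<in> C" "0 < x1 0" using small[of 1] by auto
  have "(\<lambda>_. t) \<in> C" if t: "t \<in> {0<..<x1 0}" for t
  proof -
    obtain x where x: "x \<in> C" "x 0 < t" using small[of t] t by auto
    have "t \<in> I"
      using connectedD_interval[OF \<open>connected I\<close>, of "x 0" "x1 0" t] x x1 t by (auto simp: I_def)
    then obtain y where "y \<in> C" "y 0 = t" by (auto simp: I_def)
    then show ?thesis using C unfolding cylinder_def by (elim allE[of _ y] allE[of _ "\<lambda>_. t"]) simp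
  qed
  moreover have "continuous_on {0<..<x1 0} (\<lambda>t. (\<lambda>_. t) :: nat \<Rightarrow> real)"
    by (intro continuous_on_coordinatewise_then_product continuous_on_id)
  ultimately show ?thesis unfolding curve_cell_def using x1(2)
    by (intro exI[of _ "x1 0"] conjI disjI2 exI[of _ "\<lambda>t _. t"] ballI) simp_all
qed

text \<open>On a graph the root itself is the section. In a band it is the midpoint between the two bounding roots,
  the point at distance \<open>1\<close> from the only bounding root, or \<open>0\<close> if there is no root.\<close>

lemma continuous_section_of_cell:
  assumes fin: "finite \<F>"
    and F: "\<And>F. F \<in> \<F> \<Longrightarrow> \<exists>d. coord_param_poly n d F" "\<And>F. F \<in> \<F> \<Longrightarrow> (\<lambda>x. pderiv (F x)) \<in> \<F>"
    and card: "\<And>x. x \<in> S \<Longrightarrow> card (fibre_roots \<F> x) = k"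
    and j: "j \<le> k" "b \<Longrightarrow> j < k"
  shows "\<exists>\<sigma>. continuous_on S \<sigma> \<and> (\<forall>x\<in>S. (\<sigma> x \<in> fibre_roots \<F> x \<longleftrightarrow> b) \<and>
           card (fibre_roots \<F> x \<inter> {..<\<sigma> x}) = j)"
proof -
  define \<xi> where "\<xi> i x = nth_least (fibre_roots \<F> x) i" for i x
  note finZ = finite_fibre_roots[OF fin]
  have cont: "continuous_on S (\<xi> i)" if "i < k" for i
    unfolding \<xi>_def by (rule continuous_on_nth_fibre_root[OF fin F card that])
  have \<xi>: "\<xi> i x \<in> fibre_roots \<F> x" "card (fibre_roots \<F> x \<inter> {..<\<xi> i x}) = i" if "i < k" "x \<in> S" for i x
    unfolding \<xi>_def using nth_least[OF finZ, of i x] that card by auto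
  have between: "\<sigma> \<notin> fibre_roots \<F> x \<and> card (fibre_roots \<F> x \<inter> {..<\<sigma>}) = j"
    if "x \<in> S" "0 < j \<Longrightarrow> \<xi> (j - 1) x < \<sigma>" "j < k \<Longrightarrow> \<sigma> < \<xi> j x" for x \<sigma>
    using rank_between_nth_least[OF finZ, of j x \<sigma>] that j card[OF that(1)] unfolding \<xi>_def by auto
  show ?thesis
  proof (cases b)
    case True
    then show ?thesis using cont[of j] \<xi>[of j] j by (intro exI[of _ "\<xi> j"]) auto
  next
    case False
    have "\<exists>\<sigma>. continuous_on S \<sigma> \<and> (\<forall>x\<in>S. (0 < j \<longrightarrow> \<xi> (j - 1) x < \<sigma> x) \<and> (j < k \<longrightarrow> \<sigma> x < \<xi> j x))"
    proof -
      consider "j = 0" "k = 0" | "j = 0" "0 < k" | "0 < j" "j = k" | "0 < j" "j < k" using j(1) by linarith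
      then show ?thesis
      proof cases
        case 1
        then show ?thesis by (intro exI[of _ "\<lambda>x. 0"]) simp
      next
        case 2
        have "continuous_on S (\<lambda>x. \<xi> 0 x - 1)" using cont[of 0] 2 by (intro continuous_on_diff) simp_all
        then show ?thesis using 2 by (intro exI[of _ "\<lambda>x. \<xi> 0 x - 1"]) simp
      next
        case 3
        have "continuous_on S (\<lambda>x. \<xi> (j - 1) x + 1)" using cont[of "j - 1"] 3 by (intro continuous_on_add) simp_all
        then show ?thesis using 3 by (intro exI[of _ "\<lambda>x. \<xi> (j - 1) x + 1"]) simp
      next
        case 4
        have "continuous_on S (\<lambda>x. (\<xi> (j - 1) x + \<xi> j x) / 2)"
          using cont[of "j - 1"] cont[of j] 4 by (intro continuous_on_divide continuous_on_add) simp_all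
        moreover have "\<xi> (j - 1) x < \<xi> j x" if x: "x \<in> S" for x
          unfolding \<xi>_def
          using nth_least_less_iff[OF finZ, of "j - 1" x "\<xi> j x"] \<xi>(2)[of j x] 4 card[OF x] x
          by (simp add: \<xi>_def)
        ultimately show ?thesis by (intro exI[of _ "\<lambda>x. (\<xi> (j - 1) x + \<xi> j x) / 2"]) (simp add: field_simps)
      qed
    qed
    then obtain \<sigma> where \<sigma>: "continuous_on S \<sigma>"
      "\<And>x. x \<in> S \<Longrightarrow> (0 < j \<longrightarrow> \<xi> (j - 1) x < \<sigma> x) \<and> (j < k \<longrightarrow> \<sigma> x < \<xi> j x)" by blast
    then have "\<sigma> x \<notin> fibre_roots \<F> x \<and> card (fibre_roots \<F> x \<inter> {..<\<sigma> x}) = j" if "x \<in> S" for x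
      using between[OF that, of "\<sigma> x"] \<sigma>(2)[OF that] by blast
    then show ?thesis using \<sigma>(1) False by blast
  qed
qed

text \<open>For \<open>b\<close> true this is the graph of the \<open>j\<close>-th root function over \<open>S\<close>, and for \<open>b\<close> false the band with
  exactly \<open>j\<close> roots below it.\<close>

definition root_cell :: "((nat \<Rightarrow> real) \<Rightarrow> real poly) set \<Rightarrow> nat \<Rightarrow> (nat \<Rightarrow> real) set \<Rightarrow> bool \<Rightarrow> nat \<Rightarrow> (nat \<Rightarrow> real) set" where
  "root_cell \<F> n S b j = {x \<in> S. (x n \<in> fibre_roots \<F> x \<longleftrightarrow> b) \<and> card (fibre_roots \<F> x \<inter> {..<x n}) = j}"

lemma fibre_roots_cong:
  assumes "\<And>F. F \<in> \<F> \<Longrightarrow> \<exists>d. coord_param_poly n d F" "\<And>i. i < n \<Longrightarrow> x i = y i"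
  shows "fibre_roots \<F> x = fibre_roots \<F> y"
proof -
  have eq: "F x = F y" if "F \<in> \<F>" for F
    using assms(1)[OF that] coord_param_poly_cong assms(2) by blast
  have "(\<exists>F\<in>\<F>. F x \<noteq> 0 \<and> poly (F x) u = 0) \<longleftrightarrow> (\<exists>F\<in>\<F>. F y \<noteq> 0 \<and> poly (F y) u = 0)" for u
    by (rule bex_cong[OF refl]) (simp only: eq)
  then show ?thesis unfolding fibre_roots_def by simp
qed

text \<open>Being increasing, \<open>\<phi>\<close> preserves the position relative to the roots. Hence \<open>\<phi> (x n)\<close> and \<open>y n\<close>
  are the same root over \<open>y\<close> or lie in the same gap between roots over \<open>y\<close>.\<close>

lemma root_cells_same_position:
  assumes iso: "fibre_sign_iso \<F> \<phi> x y" and fin: "finite \<F>"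
    and x: "x \<in> root_cell \<F> n S b j" and y: "y \<in> root_cell \<F> n S b j" and F: "F \<in> \<F>"
  shows "sgn (poly (F x) (x n)) = sgn (poly (F y) (y n))"
proof -
  have phi: "strict_mono \<phi>" and sg: "sgn (poly (F y) (\<phi> (x n))) = sgn (poly (F x) (x n))"
    using iso F by (auto simp: fibre_sign_iso_def)
  have inj: "inj \<phi>" using phi by (rule strict_mono_imp_inj_on)
  have Zy: "fibre_roots \<F> y = \<phi> ` fibre_roots \<F> x" by (rule fibre_sign_iso_roots[OF iso])
  have "fibre_roots \<F> y \<inter> {..<\<phi> (x n)} = \<phi> ` (fibre_roots \<F> x \<inter> {..<x n})"
    unfolding Zy using phi by (auto simp: strict_mono_less)
  then have "card (fibre_roots \<F> y \<inter> {..<\<phi> (x n)}) = card (fibre_roots \<F> x \<inter> {..<x n})"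
    by (simp add: card_image inj_on_subset[OF inj])
  then have rank: "card (fibre_roots \<F> y \<inter> {..<\<phi> (x n)}) = card (fibre_roots \<F> y \<inter> {..<y n})"
    using x y by (simp add: root_cell_def)
  have mem: "\<phi> (x n) \<in> fibre_roots \<F> y \<longleftrightarrow> b" "y n \<in> fibre_roots \<F> y \<longleftrightarrow> b"
    using x y unfolding Zy by (simp_all add: root_cell_def inj_image_mem_iff[OF inj] Zy)
  show ?thesis
  proof (cases "F y = 0")
    case True
    then show ?thesis using sg by simp
  next
    case Fy: False
    note finZ = finite_fibre_roots[OF fin]
    show ?thesis
    proof (cases b)
      case True
      then have "\<phi> (x n) = y n" using eq_of_rank_eq[OF finZ _ _ rank] mem by blast
      then show ?thesis using sg by simp
    next
      case False
      have "sgn (poly (F y) (\<phi> (x n))) = sgn (poly (F y) (y n))"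
      proof (rule sgn_poly_eq_of_no_root)
        fix u assume "min (\<phi> (x n)) (y n) \<le> u" "u \<le> max (\<phi> (x n)) (y n)"
        then have "u \<notin> fibre_roots \<F> y" using rank_eq_imp_gap(1)[OF finZ _ _ rank] mem False by blast
        then show "poly (F y) u \<noteq> 0" using F Fy by (auto simp: fibre_roots_def)
      qed
      then show ?thesis using sg by simp
    qed
  qed
qed

text \<open>As the sign pattern is constant over \<open>S\<close>, so is the number of roots, and the cell has a section over
  all of \<open>S\<close>. Its fibres are single points or open intervals.\<close>

lemma root_cell_cylinder_path_connected_curve:
  assumes fin: "finite \<F>"
    and F: "\<And>F. F \<in> \<F> \<Longrightarrow> \<exists>d. coord_param_poly n d F" "\<And>F. F \<in> \<F> \<Longrightarrow> (\<lambda>x. pderiv (F x)) \<in> \<F>"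
    and iso: "\<And>x y. x \<in> S \<Longrightarrow> y \<in> S \<Longrightarrow> \<exists>\<phi>. fibre_sign_iso \<F> \<phi> x y"
    and S: "cylinder n S" "path_connected S" "n > 0 \<Longrightarrow> curve_cell S"
    and C: "C = root_cell \<F> n S b j"
  shows "cylinder (Suc n) C" "path_connected C" "curve_cell C"
proof -
  note finZ = finite_fibre_roots[OF fin]
  have upd: "x(n := t) \<in> S \<longleftrightarrow> x \<in> S" for x t
  proof
    assume "x(n := t) \<in> S" then show "x \<in> S"
      using S(1) unfolding cylinder_def by (elim allE[of _ "x(n := t)"] allE[of _ x]) simp
  next
    assume "x \<in> S" then show "x(n := t) \<in> S"
      using S(1) unfolding cylinder_def by (elim allE[of _ "x(n := t)"] allE[of _ x]) simp
  qed
  have updZ: "fibre_roots \<F> (x(n := t)) = fibre_roots \<F> x" for x t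
    by (rule fibre_roots_cong[OF F(1)]) simp_all
  have updC: "x(n := t) \<in> C \<longleftrightarrow> x \<in> S \<and> (t \<in> fibre_roots \<F> x \<longleftrightarrow> b) \<and> card (fibre_roots \<F> x \<inter> {..<t}) = j" for x t
    unfolding C root_cell_def by (simp add: upd updZ)
  have CS: "C \<subseteq> S" unfolding C root_cell_def by blast
  show cyl: "cylinder (Suc n) C"
    unfolding cylinder_def
  proof (intro allI impI)
    fix x y assume xy: "\<forall>i<Suc n. x i = y i" and x: "x \<in> C"
    have "x \<in> S" using x CS by blast
    moreover have "\<forall>i<n. x i = y i" using xy by simp
    ultimately have "y \<in> S" using S(1) unfolding cylinder_def by blast
    moreover have "fibre_roots \<F> x = fibre_roots \<F> y"
      by (rule fibre_roots_cong[OF F(1)]) (use xy in simp_all)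
    ultimately show "y \<in> C" using x xy unfolding C root_cell_def by simp
  qed
  have "path_connected C \<and> curve_cell C"
  proof (cases "C = {}")
    case True
    then show ?thesis unfolding curve_cell_def by (intro conjI exI[of _ 1] disjI1) simp_all
  next
    case False
    then obtain x0 where x0: "x0 \<in> C" by blast
    define k where "k = card (fibre_roots \<F> x0)"
    have card: "card (fibre_roots \<F> x) = k" if x: "x \<in> S" for x
    proof -
      obtain \<phi> where \<phi>: "fibre_sign_iso \<F> \<phi> x0 x" using iso[of x0 x] x0 CS x by blast
      then have inj: "inj \<phi>" by (intro strict_mono_imp_inj_on) (simp add: fibre_sign_iso_def)
      show ?thesis unfolding k_def fibre_sign_iso_roots[OF \<phi>]
        by (rule card_image[OF inj_on_subset[OF inj subset_UNIV]])
    qed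
    have x0': "x0 n \<in> fibre_roots \<F> x0 \<longleftrightarrow> b" "card (fibre_roots \<F> x0 \<inter> {..<x0 n}) = j"
      using x0 unfolding C root_cell_def by simp_all
    have "j \<le> k" unfolding k_def x0'(2)[symmetric] by (rule card_mono[OF finZ]) simp
    moreover have "j < k" if b
    proof -
      have "fibre_roots \<F> x0 \<inter> {..<x0 n} \<subset> fibre_roots \<F> x0" using that x0'(1) by blast
      then show ?thesis unfolding k_def x0'(2)[symmetric] by (rule psubset_card_mono[OF finZ])
    qed
    ultimately have "\<exists>\<sigma>. continuous_on S \<sigma> \<and> (\<forall>x\<in>S. (\<sigma> x \<in> fibre_roots \<F> x \<longleftrightarrow> b) \<and>
           card (fibre_roots \<F> x \<inter> {..<\<sigma> x}) = j)"
      using continuous_section_of_cell[OF fin F card] by simp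
    then obtain \<sigma> where \<sigma>: "continuous_on S \<sigma>" "\<And>x. x \<in> S \<Longrightarrow> (\<sigma> x \<in> fibre_roots \<F> x \<longleftrightarrow> b) \<and>
           card (fibre_roots \<F> x \<inter> {..<\<sigma> x}) = j"
      by blast
    have sec: "x(n := \<sigma> x) \<in> C" if "x \<in> S" for x using \<sigma>(2)[OF that] that updC by blast
    have "path_connected C"
    proof (rule path_connected_over_section[OF S(2) CS \<sigma>(1) sec])
      fix x s u assume s: "x(n := s) \<in> C" and u: "x(n := u) \<in> C"
      show "closed_segment s u \<subseteq> {t. x(n := t) \<in> C}"
      proof
        fix t assume t: "t \<in> closed_segment s u"
        then have t': "min s u \<le> t" "t \<le> max s u"
          by (auto simp: closed_segment_eq_real_ivl split: if_splits)
        have rank: "card (fibre_roots \<F> x \<inter> {..<s}) = card (fibre_roots \<F> x \<inter> {..<u})"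
          using s u by (simp add: updC)
        have "x(n := t) \<in> C"
        proof (cases b)
          case True
          then have "s = u" using s u eq_of_rank_eq[OF finZ _ _ rank] by (simp add: updC)
          then show ?thesis using t' s by simp
        next
          case False
          then have "s \<notin> fibre_roots \<F> x" "u \<notin> fibre_roots \<F> x" using s u by (simp_all add: updC)
          then have "t \<notin> fibre_roots \<F> x" "card (fibre_roots \<F> x \<inter> {..<t}) = card (fibre_roots \<F> x \<inter> {..<s})"
            using rank_eq_imp_gap[OF finZ _ _ rank t'] by blast+
          then show ?thesis using s False by (simp add: updC)
        qed
        then show "t \<in> {t. x(n := t) \<in> C}" by simp
      qed
    qed
    moreover have "curve_cell C"
    proof (cases "n = 0")
      case True
      then show ?thesis using curve_cell_of_dimension_one cyl \<open>path_connected C\<close> by simp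
    next
      case False
      then show ?thesis using curve_cell_over_section[OF S(3) CS _ \<sigma>(1) sec] by simp
    qed
    ultimately show ?thesis by blast
  qed
  then show "path_connected C" "curve_cell C" by blast+
qed

lemma derivative_closed_family:
  assumes "finite P" "\<And>p. p \<in> P \<Longrightarrow> \<exists>d. coord_param_poly n d (F p)"
  shows "\<exists>\<F>. finite \<F> \<and> F ` P \<subseteq> \<F> \<and>
    (\<forall>G\<in>\<F>. (\<exists>d. coord_param_poly n d G) \<and> (\<lambda>x. pderiv (G x)) \<in> \<F>)"
proof -
  obtain d where d: "\<And>p. p \<in> P \<Longrightarrow> coord_param_poly n (d p) (F p)" using assms(2) by metis
  define D where "D p i = (\<lambda>x. (pderiv ^^ i) (F p x))" for p i
  have D: "coord_param_poly n (d p - i) (D p i)" if "p \<in> P" for p i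
  proof (induction i)
    case 0
    then show ?case using d[OF that] by (simp add: D_def)
  next
    case (Suc i)
    then show ?case using coord_polys.param_poly_pderiv[OF Suc] by (simp add: D_def)
  qed
  \<comment> \<open>The derivative of order \<open>d p\<close> is zero, hence its own derivative; this closes the finite family.\<close>
  define \<F> where "\<F> = (\<Union>p\<in>P. D p ` {..d p})"
  have "(\<lambda>x. pderiv (D p i x)) \<in> \<F>" if p: "p \<in> P" "i \<le> d p" for p i
  proof (cases "i = d p")
    case True
    then have "D p i x = 0" for x
      using D[OF p(1), of i] by (simp add: coord_polys.param_poly_def poly_eq_iff)
    then have "(\<lambda>x. pderiv (D p i x)) = D p i" by (simp add: fun_eq_iff)
    then show ?thesis using p by (auto simp: \<F>_def)
  next
    case False
    have "(\<lambda>x. pderiv (D p i x)) = D p (Suc i)" by (simp add: D_def)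
    then show ?thesis using p False unfolding \<F>_def by (intro UN_I[OF p(1)] image_eqI[of _ _ "Suc i"]) simp_all
  qed
  then have "(\<lambda>x. pderiv (G x)) \<in> \<F>" if "G \<in> \<F>" for G using that unfolding \<F>_def by blast
  moreover have "\<exists>d. coord_param_poly n d G" if "G \<in> \<F>" for G using that D unfolding \<F>_def by blast
  moreover have "finite \<F>" using assms(1) by (simp add: \<F>_def)
  moreover have "F p \<in> \<F>" if "p \<in> P" for p
    unfolding \<F>_def using that by (intro UN_I[OF that] image_eqI[of _ _ 0]) (simp_all add: D_def)
  ultimately show ?thesis by blast
qed

text \<open>In the step, the space of the first \<open>n\<close> coordinates is decomposed by a set of polynomials that decides
  the sign pattern of the fibres, and each cell is then split along the roots over it.\<close>

theorem cylindrical_decomposition: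
  assumes "finite P" and "P \<subseteq> coord_polys n"
  shows "\<exists>\<C>. finite \<C> \<and> \<Union>\<C> = UNIV \<and> (\<forall>C\<in>\<C>. cylinder n C \<and> path_connected C \<and>
           (0 < n \<longrightarrow> curve_cell C) \<and> (\<forall>x\<in>C. \<forall>y\<in>C. same_signs P x y))"
  using assms
proof (induction n arbitrary: P)
  case 0
  have "path_connected (UNIV :: (nat \<Rightarrow> real) set)"
    unfolding path_connected_def
  proof (intro ballI)
    fix x y :: "nat \<Rightarrow> real"
    have "path (\<lambda>t i. (1 - t) * x i + t * y i)"
      unfolding path_def by (intro continuous_on_coordinatewise_then_product continuous_intros)
    then show "\<exists>g. path g \<and> path_image g \<subseteq> UNIV \<and> pathstart g = x \<and> pathfinish g = y"
      by (intro exI[of _ "\<lambda>t i. (1 - t) * x i + t * y i"]) (simp add: pathstart_def pathfinish_def)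
  qed
  moreover have "same_signs P x y" for x y
    unfolding same_signs_def
  proof
    fix q assume "q \<in> P"
    then have "q \<in> coord_polys 0" using 0(2) by blast
    then have "q x = q y" by (rule coord_polys_cong) simp
    then show "sgn (q x) = sgn (q y)" by simp
  qed
  ultimately show ?case by (intro exI[of _ "{UNIV}"]) (simp add: cylinder_def)
next
  case (Suc n)
  obtain F where F: "\<And>p. p \<in> P \<Longrightarrow> \<exists>d. coord_param_poly n d (F p)"
    "\<And>p x y. p \<in> P \<Longrightarrow> p (x(n := y)) = poly (F p x) y"
    using coord_polys_family_as_param_polys[OF Suc.prems(2)] by metis
  have "\<exists>\<F>. finite \<F> \<and> F ` P \<subseteq> \<F> \<and>
      (\<forall>G\<in>\<F>. (\<exists>d. coord_param_poly n d G) \<and> (\<lambda>x. pderiv (G x)) \<in> \<F>)"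
    by (rule derivative_closed_family[OF Suc.prems(1)]) (rule F(1))
  then obtain \<F> where "finite \<F>" "F ` P \<subseteq> \<F>"
    and "\<forall>G\<in>\<F>. (\<exists>d. coord_param_poly n d G) \<and> (\<lambda>x. pderiv (G x)) \<in> \<F>"
    by (elim exE conjE) (rule that)
  then have \<F>: "finite \<F>" "F ` P \<subseteq> \<F>" "\<And>G. G \<in> \<F> \<Longrightarrow> \<exists>d. coord_param_poly n d G"
    "\<And>G. G \<in> \<F> \<Longrightarrow> (\<lambda>x. pderiv (G x)) \<in> \<F>"
    by simp_all
  obtain Q where Q: "finite Q" "Q \<subseteq> coord_polys n"
    "\<And>x x'. same_signs Q x x' \<Longrightarrow> \<exists>\<phi>. fibre_sign_iso \<F> \<phi> x x'"
    using coord_polys.fibre_sign_iso_exists[OF \<F>(1,3)] by blast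
  from Suc.IH[OF Q(1,2)] obtain \<S> where \<S>: "finite \<S>" "\<Union>\<S> = UNIV"
    and \<S>_cell: "\<forall>S\<in>\<S>. cylinder n S \<and> path_connected S \<and> (0 < n \<longrightarrow> curve_cell S) \<and>
           (\<forall>x\<in>S. \<forall>y\<in>S. same_signs Q x y)"
    by (elim exE conjE) (rule that)
  have iso: "\<exists>\<phi>. fibre_sign_iso \<F> \<phi> x y" if "S \<in> \<S>" "x \<in> S" "y \<in> S" for S x y
    by (rule Q(3)) (use \<S>_cell that in blast)
  define k where "k S = card (fibre_roots \<F> (SOME x. x \<in> S))" for S
  have k: "card (fibre_roots \<F> x) = k S" if S: "S \<in> \<S>" and x: "x \<in> S" for S x
  proof -
    have "(SOME x. x \<in> S) \<in> S" using x some_in_eq[of S] by blast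
    then obtain \<phi> where \<phi>: "fibre_sign_iso \<F> \<phi> (SOME x. x \<in> S) x" using iso[OF S _ x] by blast
    then have inj: "inj \<phi>" by (intro strict_mono_imp_inj_on) (simp add: fibre_sign_iso_def)
    show ?thesis unfolding k_def fibre_sign_iso_roots[OF \<phi>]
      by (rule card_image[OF inj_on_subset[OF inj subset_UNIV]])
  qed
  define \<C> where "\<C> = (\<Union>S\<in>\<S>. (\<lambda>(b, j). root_cell \<F> n S b j) ` (UNIV \<times> {..k S}))"
  have "finite \<C>" unfolding \<C>_def using \<S>(1) by (intro finite_UN_I finite_imageI) simp_all
  moreover have "x \<in> \<Union>\<C>" for x
  proof -
    have "x \<in> \<Union>\<S>" using \<S>(2) by simp
    then obtain S where S: "S \<in> \<S>" "x \<in> S" by (rule UnionE)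
    define b j where "b = (x n \<in> fibre_roots \<F> x)" and "j = card (fibre_roots \<F> x \<inter> {..<x n})"
    have "j \<le> k S" unfolding j_def k[OF S, symmetric]
      by (rule card_mono[OF finite_fibre_roots[OF \<F>(1)]]) simp
    then have "(b, j) \<in> UNIV \<times> {..k S}" by simp
    then have "(case (b, j) of (b, j) \<Rightarrow> root_cell \<F> n S b j) \<in> \<C>"
      unfolding \<C>_def by (intro UN_I[OF S(1)] imageI)
    then have "root_cell \<F> n S b j \<in> \<C>" by simp
    moreover have "x \<in> root_cell \<F> n S b j" using S by (simp add: root_cell_def b_def j_def)
    ultimately show ?thesis by (rule UnionI)
  qed
  then have "\<Union>\<C> = UNIV" by blast
  moreover have "\<forall>C\<in>\<C>. cylinder (Suc n) C \<and> path_connected C \<and> (0 < Suc n \<longrightarrow> curve_cell C) \<and>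
      (\<forall>x\<in>C. \<forall>y\<in>C. same_signs P x y)"
  proof
    fix C assume C: "C \<in> \<C>"
    obtain S b j where S: "S \<in> \<S>" and Cdef: "C = root_cell \<F> n S b j" using C by (auto simp: \<C>_def)
    have Sc: "cylinder n S" "path_connected S" "0 < n \<Longrightarrow> curve_cell S" using \<S>_cell S by simp_all
    note props = root_cell_cylinder_path_connected_curve[OF \<F>(1,3,4) iso[OF S] Sc Cdef]
    have "same_signs P x y" if x: "x \<in> C" and y: "y \<in> C" for x y
      unfolding same_signs_def
    proof
      fix p assume p: "p \<in> P"
      have "x \<in> S" "y \<in> S" using x y by (auto simp: Cdef root_cell_def)
      then obtain \<phi> where \<phi>: "fibre_sign_iso \<F> \<phi> x y" using iso[OF S] by blast
      have "F p \<in> \<F>" using \<F>(2) p by blast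
      from root_cells_same_position[OF \<phi> \<F>(1) x[unfolded Cdef] y[unfolded Cdef] this]
      show "sgn (p x) = sgn (p y)" using F(2)[OF p, of x "x n"] F(2)[OF p, of y "y n"] by simp
    qed
    then show "cylinder (Suc n) C \<and> path_connected C \<and> (0 < Suc n \<longrightarrow> curve_cell C) \<and>
      (\<forall>x\<in>C. \<forall>y\<in>C. same_signs P x y)"
      using props by (intro conjI impI ballI)
  qed
  ultimately show ?case by (intro exI[of _ \<C>] conjI)
qed

section \<open>Connected components of semialgebraic sets\<close>

text \<open>There are finitely many path components, and by the last hypothesis each is relatively closed. So a
  connected component that met two of them would be a disjoint union of two relatively closed sets.\<close>

lemma components_of_finite_union_of_path_connected:
  fixes S :: "'a::real_normed_vector set"
  assumes fin: "finite \<D>" and S: "S = \<Union>\<D>" and pc: "\<And>D. D \<in> \<D> \<Longrightarrow> path_connected D"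
    and closed: "\<And>a x. a \<in> S \<Longrightarrow> x \<in> S \<Longrightarrow> a \<in> closure (path_component_set S x) \<Longrightarrow> path_component S x a"
  shows "finite (components S) \<and> (\<forall>C\<in>components S. path_connected C)"
proof -
  define PC where "PC = path_component_set S ` S"
  have eq: "path_component_set S x = path_component_set S y" if "path_component S x y" for x y
  proof (rule set_eqI)
    fix z
    show "z \<in> path_component_set S x \<longleftrightarrow> z \<in> path_component_set S y"
      unfolding mem_Collect_eq using that path_component_sym path_component_trans by metis
  qed
  have "PC \<subseteq> (\<lambda>D. path_component_set S (SOME x. x \<in> D)) ` \<D>"
  proof
    fix P assume "P \<in> PC"
    then obtain x where x: "x \<in> S" "P = path_component_set S x" by (auto simp: PC_def)
    obtain D where D: "D \<in> \<D>" "x \<in> D" using x(1) S by blast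
    have "(SOME x. x \<in> D) \<in> D" using D(2) some_in_eq[of D] by blast
    then have "path_component D x (SOME x. x \<in> D)"
      using pc[OF D(1)] D(2) unfolding path_connected_component by blast
    then have "path_component S x (SOME x. x \<in> D)"
      by (rule path_component_of_subset[rotated]) (use D(1) S in blast)
    then show "P \<in> (\<lambda>D. path_component_set S (SOME x. x \<in> D)) ` \<D>"
      using eq x(2) D(1) by blast
  qed
  then have finPC: "finite PC" using fin by (rule finite_subset[OF _ finite_imageI])
  have "C \<in> PC \<and> path_connected C" if C: "C \<in> components S" for C
  proof -
    obtain x where x: "x \<in> S" "C = connected_component_set S x" using C by (auto simp: components_def)
    define P where "P = path_component_set S x"
    have P: "P \<in> PC" using x(1) by (simp add: P_def PC_def)
    have PsubC: "P \<subseteq> C" unfolding P_def x(2) by (rule path_component_subset_connected_component)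
    have xP: "x \<in> P" using x(1) by (simp add: P_def path_component_refl)
    have CS: "C \<subseteq> S" using C by (rule in_components_subset)
    have closed_in: "a \<in> P'" if P': "P' \<in> PC" and a: "a \<in> S" "a \<in> closure P'" for a P'
    proof -
      obtain y where "y \<in> S" "P' = path_component_set S y" using P' by (auto simp: PC_def)
      then show ?thesis using closed[OF a(1), of y] a(2) by simp
    qed
    have disj: "P' = P" if P': "P' \<in> PC" and a: "a \<in> P'" "a \<in> P" for a P'
    proof -
      obtain y where y: "P' = path_component_set S y" using P' by (auto simp: PC_def)
      then have "path_component S y a" "path_component S x a" using a by (simp_all add: P_def)
      then have "path_component_set S y = path_component_set S a" "path_component_set S x = path_component_set S a"
        by (simp_all only: eq)
      then show ?thesis by (simp only: y P_def)
    qed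
    have "C \<subseteq> P"
    proof (rule ccontr)
      assume "\<not> C \<subseteq> P"
      then obtain b where b: "b \<in> C" "b \<notin> P" by blast
      define B where "B = (\<Union>P'\<in>PC - {P}. closure P')"
      have "closed B" unfolding B_def using finPC by (intro closed_UN) simp_all
      have cover: "a \<in> closure P \<union> B" if a: "a \<in> C" for a
      proof -
        have "a \<in> S" using a CS by blast
        then have Q: "path_component_set S a \<in> PC" "a \<in> path_component_set S a"
          by (simp_all add: PC_def path_component_refl)
        have acl: "a \<in> closure (path_component_set S a)" using closure_subset Q(2) by (rule subsetD)
        show ?thesis
        proof (cases "path_component_set S a = P")
          case True
          then show ?thesis using acl by simp
        next
          case False
          then have "a \<in> B" unfolding B_def using acl Q(1) by (intro UN_I[of "path_component_set S a"]) simp_all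
          then show ?thesis by simp
        qed
      qed
      have "closure P \<inter> B \<inter> C = {}"
      proof (rule equals0I)
        fix a assume a: "a \<in> closure P \<inter> B \<inter> C"
        then have "a \<in> S" using CS by blast
        then have "a \<in> P" using closed_in[OF P] a by blast
        obtain P' where P': "P' \<in> PC" "P' \<noteq> P" "a \<in> closure P'" using a unfolding B_def by blast
        then have "a \<in> P'" using closed_in[OF P'(1) \<open>a \<in> S\<close>] by blast
        then show False using disj[OF P'(1) _ \<open>a \<in> P\<close>] P'(2) by blast
      qed
      moreover have "x \<in> closure P \<inter> C" using xP PsubC closure_subset by blast
      moreover have "b \<in> B \<inter> C"
      proof -
        have "b \<in> closure P \<Longrightarrow> b \<in> P" using closed_in[OF P] b(1) CS by blast
        then show ?thesis using cover[OF b(1)] b by blast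
      qed
      moreover have "connected C" using C by (rule in_components_connected)
      moreover have "C \<subseteq> closure P \<union> B" using cover by blast
      ultimately show False
        using connected_closedD[of C "closure P" B] \<open>closed B\<close> closed_closure by blast
    qed
    then have "C = P" using PsubC by blast
    then show ?thesis using P by (simp add: P_def path_connected_path_component)
  qed
  then show ?thesis using finite_subset[OF _ finPC] by blast
qed

lemma real_polynomial_function_compose_coord_polys:
  fixes g :: "(nat \<Rightarrow> real) \<Rightarrow> real ^ 'n"
  assumes "real_polynomial_function p" and g: "\<And>i. (\<lambda>z. g z $ i) \<in> coord_polys m"
  shows "(\<lambda>z. p (g z)) \<in> coord_polys m"
  using assms(1)
proof (induction rule: real_polynomial_function.induct)
  case (linear f)
  then have lin: "linear f" by (rule bounded_linear.linear)
  have "f (g z) = (\<Sum>i\<in>UNIV. g z $ i * f (axis i 1))" for z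
  proof -
    have "f (g z) = f (\<Sum>i\<in>UNIV. g z $ i *\<^sub>R axis i 1)"
      using basis_expansion[of "g z"] by (simp add: scalar_mult_eq_scaleR)
    also have "\<dots> = (\<Sum>i\<in>UNIV. g z $ i * f (axis i 1))"
      by (simp add: linear_sum[OF lin] linear_scale[OF lin])
    finally show ?thesis .
  qed
  then show ?case using g by (simp only:) (intro coord_polys.sum_mem coord_polys.mult coord_polys.const, simp_all)
qed (auto intro: coord_polys.intros)

lemma coord_polys_compose_real_polynomial_function:
  assumes "q \<in> coord_polys m" and "\<And>j. j < m \<Longrightarrow> real_polynomial_function (\<lambda>v. e v j)"
  shows "real_polynomial_function (\<lambda>v. q (e v))"
  using assms by (induction rule: coord_polys.induct) auto

text \<open>The curve extends continuously to parameter \<open>0\<close> with value \<open>a\<close>.\<close>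

lemma path_component_of_shrinking_curve:
  fixes c :: "real \<Rightarrow> 'a::real_normed_vector"
  assumes "0 < e" and c: "continuous_on {0<..<e} c"
    and cS: "\<And>t. t \<in> {0<..<e} \<Longrightarrow> c t \<in> S" and near: "\<And>t. t \<in> {0<..<e} \<Longrightarrow> dist (c t) a < t"
    and "a \<in> S" and t0: "t0 \<in> {0<..<e}"
  shows "path_component S (c t0) a"
proof -
  define g where "g t = (if t \<le> 0 then a else c t)" for t
  have "continuous_on {0..t0} g"
    unfolding continuous_on_eq_continuous_within
  proof
    fix t assume t: "t \<in> {0..t0}"
    show "continuous (at t within {0..t0}) g"
    proof (cases "t = 0")
      case True
      have "dist (g u) (g t) < r" if "u \<in> {0..t0}" "dist u t < r" for u r
        using that near[of u] t0 True by (cases "u = 0") (simp_all add: g_def)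
      then show ?thesis unfolding continuous_within_eps_delta by blast
    next
      case False
      then have te: "t \<in> {0<..<e}" "0 < t" using t t0 by simp_all
      have "isCont c t" using c te(1) by (simp add: continuous_on_eq_continuous_at)
      then have "continuous (at t within {0..t0}) c" by (rule continuous_at_imp_continuous_at_within)
      then show ?thesis
      proof (rule continuous_transform_within[OF _ te(2) t])
        fix u assume "dist u t < t"
        then have "\<not> u \<le> 0" by (simp add: dist_real_def abs_less_iff)
        then show "c u = g u" by (simp add: g_def)
      qed
    qed
  qed
  then have "path_connected (g ` {0..t0})"
    by (rule path_connected_continuous_image) (simp add: convex_imp_path_connected)
  then have "path_component (g ` {0..t0}) (g t0) (g 0)"
    using t0 unfolding path_connected_component by simp
  moreover have "g u \<in> S" if "u \<in> {0..t0}" for u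
    using that cS[of u] t0 \<open>a \<in> S\<close> by (simp add: g_def)
  then have "g ` {0..t0} \<subseteq> S" by blast
  ultimately have "path_component S (g t0) (g 0)" by (rule path_component_of_subset[rotated])
  then show ?thesis using t0 by (simp add: g_def)
qed

text \<open>The space \<open>\<real>\<^sup>n\<close> is identified with the coordinates \<open>1, \<dots>, n\<close> of a sequence; coordinate \<open>0\<close> is
  reserved for the curve parameter, which has to be the lowest level of the decomposition. If \<open>a\<close> is a
  limit of the path component of \<open>x\<close>, a cell that meets this path component at distance less
  than a small \<open>t\<close> from \<open>a\<close> at height \<open>t\<close> lies entirely in that path component, and its curve leads to \<open>a\<close>.\<close>

theorem semialgebraic_components:
  fixes S :: "(real ^ 'n) set"
  assumes "semialgebraic S"
  shows "finite (components S) \<and> (\<forall>C\<in>components S. path_connected C)"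
proof -
  obtain P where P: "finite P" "P \<subseteq> Collect real_polynomial_function"
    "\<And>x y. same_signs P x y \<Longrightarrow> (x \<in> S \<longleftrightarrow> y \<in> S)"
    using assms unfolding semialgebraic_iff_sign_determined sign_determined_def by metis
  define N where "N = CARD('n)"
  obtain h where "bij_betw h (UNIV :: 'n set) {0..<N}"
    unfolding N_def using ex_bij_betw_finite_nat[of "UNIV :: 'n set"] by auto
  then have h_inj: "inj h" and "range h = {0..<N}" by (simp_all add: bij_betw_def)
  then have hN: "h i < N" for i by (metis atLeastLessThan_iff rangeI)
  define point where "point z = (\<chi> i. z (Suc (h i)))" for z :: "nat \<Rightarrow> real"
  have point_surj: "\<exists>z. point z = v \<and> z 0 = t" for v t
    by (rule exI[of _ "\<lambda>j. if j = 0 then t else v $ inv h (j - 1)"])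
      (simp add: point_def vec_eq_iff h_inj)
  have point_cont: "continuous_on T point" for T
    unfolding point_def
    by (intro continuous_on_vec_lambda continuous_on_subset[OF continuous_on_product_coordinates]) simp
  have point_poly: "(\<lambda>z. p (point z)) \<in> coord_polys (Suc N)" if "real_polynomial_function p" for p
    using that by (rule real_polynomial_function_compose_coord_polys) (simp add: point_def coord_polys.coord hN)
  define R where "R = (\<lambda>p z. p (point z)) ` P"
  have R: "finite R" "R \<subseteq> coord_polys (Suc N)" using P(1,2) point_poly by (auto simp: R_def)
  have RS: "point z \<in> S \<longleftrightarrow> point w \<in> S" if "same_signs R z w" for z w
    using that by (intro P(3)) (simp add: same_signs_def R_def)
  have "\<exists>\<D>. finite \<D> \<and> S = \<Union>\<D> \<and> (\<forall>D\<in>\<D>. path_connected D)"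
  proof -
    obtain \<C> where \<C>: "finite \<C>" "\<Union>\<C> = UNIV"
      and cells: "\<forall>C\<in>\<C>. cylinder (Suc N) C \<and> path_connected C \<and> (0 < Suc N \<longrightarrow> curve_cell C) \<and>
        (\<forall>x\<in>C. \<forall>y\<in>C. same_signs R x y)"
      using cylindrical_decomposition[OF R] by (elim exE conjE) (rule that)
    define \<D> where "\<D> = (`) point ` {C \<in> \<C>. point ` C \<subseteq> S}"
    have "finite \<D>" using \<C>(1) by (simp add: \<D>_def)
    moreover have "path_connected D" if "D \<in> \<D>" for D
      using that cells by (auto simp: \<D>_def intro!: path_connected_continuous_image point_cont)
    moreover have "S = \<Union>\<D>"
    proof
      show "\<Union>\<D> \<subseteq> S" by (auto simp: \<D>_def)
      show "S \<subseteq> \<Union>\<D>"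
      proof
        fix v assume v: "v \<in> S"
        obtain z where z: "point z = v" using point_surj by blast
        have "z \<in> \<Union>\<C>" using \<C>(2) by simp
        then obtain C where C: "C \<in> \<C>" "z \<in> C" by (rule UnionE)
        have "point w \<in> S" if "w \<in> C" for w
          using RS[of z w] cells C that z v by simp
        then have "point ` C \<in> \<D>" unfolding \<D>_def using C(1) by (intro imageI) blast
        moreover have "v \<in> point ` C" using C(2) z by blast
        ultimately show "v \<in> \<Union>\<D>" by (rule UnionI)
      qed
    qed
    ultimately show ?thesis by blast
  qed
  then obtain \<D> where \<D>: "finite \<D>" "S = \<Union>\<D>" "\<forall>D\<in>\<D>. path_connected D" by (elim exE conjE) (rule that)
  show ?thesis
  proof (rule components_of_finite_union_of_path_connected[OF \<D>(1,2)])
    show "path_connected D" if "D \<in> \<D>" for D using \<D>(3) that by blast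
    fix a x assume a: "a \<in> S" and x: "x \<in> S" and cl: "a \<in> closure (path_component_set S x)"
    define p0 where "p0 z = z 0" for z :: "nat \<Rightarrow> real"
    define p1 where "p1 z = (norm (point z - a))\<^sup>2 - (z 0)\<^sup>2" for z
    have "(\<lambda>z. z 0) \<in> coord_polys (Suc N)" by (simp add: coord_polys.coord)
    moreover have "(\<lambda>z. (norm (point z - a))\<^sup>2) \<in> coord_polys (Suc N)"
    proof -
      have "(norm (point z - a))\<^sup>2 = (\<Sum>i\<in>UNIV. (z (Suc (h i)) - a $ i) * (z (Suc (h i)) - a $ i))" for z
        unfolding power2_norm_eq_inner by (simp add: inner_vec_def point_def)
      then show ?thesis
        by (simp only:) (intro coord_polys.sum_mem coord_polys.mult coord_polys.diff_mem coord_polys.const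
            coord_polys.coord; simp add: hN)
    qed
    ultimately have R'_sub: "insert p0 (insert p1 R) \<subseteq> coord_polys (Suc N)"
      using R(2) unfolding p0_def[abs_def] p1_def[abs_def] power2_eq_square[of "_ 0"]
      by (simp add: coord_polys.diff_mem coord_polys.mult)
    have "finite (insert p0 (insert p1 R))" using R(1) by simp
    from cylindrical_decomposition[OF this R'_sub] obtain \<C> where \<C>: "finite \<C>" "\<Union>\<C> = UNIV"
      and cells: "\<forall>C\<in>\<C>. cylinder (Suc N) C \<and> path_connected C \<and> (0 < Suc N \<longrightarrow> curve_cell C) \<and>
        (\<forall>x\<in>C. \<forall>y\<in>C. same_signs (insert p0 (insert p1 R)) x y)"
      by (elim exE conjE) (rule that)
    have "\<forall>C\<in>\<C>. \<exists>e>0. (\<forall>x\<in>C. \<not> (0 < x 0 \<and> x 0 < e)) \<or>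
       (\<exists>\<gamma>. continuous_on {0<..<e} \<gamma> \<and> (\<forall>t\<in>{0<..<e}. \<gamma> t \<in> C \<and> \<gamma> t 0 = t))"
      using cells unfolding curve_cell_def by blast
    from bchoice[OF this] obtain e where e: "\<And>C. C \<in> \<C> \<Longrightarrow> 0 < e C"
      and curve: "\<And>C. C \<in> \<C> \<Longrightarrow> (\<forall>x\<in>C. \<not> (0 < x 0 \<and> x 0 < e C)) \<or>
       (\<exists>\<gamma>. continuous_on {0<..<e C} \<gamma> \<and> (\<forall>t\<in>{0<..<e C}. \<gamma> t \<in> C \<and> \<gamma> t 0 = t))"
      by blast
    \<comment> \<open>Below all the thresholds \<open>e C\<close>, so that every cell with a point at height \<open>t\<close> has a curve.\<close>
    define t where "t = Min (insert 1 (e ` \<C>)) / 2"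
    have "Min (insert 1 (e ` \<C>)) > 0" using e \<C>(1) by (subst Min_gr_iff) auto
    then have t: "t > 0" by (simp add: t_def)
    have t_less: "t < e C" if "C \<in> \<C>" for C
    proof -
      have "Min (insert 1 (e ` \<C>)) \<le> e C" using \<C>(1) that by (intro Min_le) auto
      then show ?thesis using t unfolding t_def by linarith
    qed
    obtain y where y: "path_component S x y" "dist y a < t"
      using cl t unfolding closure_approachable by auto
    have yS: "y \<in> S" using path_component_mem(2)[OF y(1)] .
    obtain z where z: "point z = y" "z 0 = t" using point_surj by blast
    have "z \<in> \<Union>\<C>" using \<C>(2) by simp
    then obtain C where C: "C \<in> \<C>" "z \<in> C" by (rule UnionE)
    have "\<not> (\<forall>x\<in>C. \<not> (0 < x 0 \<and> x 0 < e C))" using C z(2) t t_less[OF C(1)] by blast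
    then obtain \<gamma> where \<gamma>: "continuous_on {0<..<e C} \<gamma>" "\<And>s. s \<in> {0<..<e C} \<Longrightarrow> \<gamma> s \<in> C \<and> \<gamma> s 0 = s"
      using curve[OF C(1)] by blast
    have same: "same_signs (insert p0 (insert p1 R)) z w" if "w \<in> C" for w
      using cells C that by blast
    have CS: "point w \<in> S" if "w \<in> C" for w
      using RS[of z w] same[OF that] z yS by (simp add: same_signs_def)
    have Cnear: "dist (point w) a < w 0" if w: "w \<in> C" for w
    proof -
      have "sgn (p0 z) = sgn (p0 w)" "sgn (p1 z) = sgn (p1 w)"
        using same[OF w] by (simp_all add: same_signs_def)
      moreover have "p0 z > 0" using z t by (simp add: p0_def)
      moreover have "p1 z < 0" using y(2) z t by (simp add: p1_def dist_norm power_strict_mono)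
      ultimately have "p0 w > 0" "p1 w < 0" by (metis sgn_greater, metis sgn_less)
      then show ?thesis unfolding p0_def p1_def dist_norm using power_less_imp_less_base[of _ 2 "w 0"] by simp
    qed
    have to_a: "path_component S (point (\<gamma> t)) a"
    proof (rule path_component_of_shrinking_curve[where c = "\<lambda>s. point (\<gamma> s)" and e = "e C"])
      show "0 < e C" using e C(1) by blast
      show "continuous_on {0<..<e C} (\<lambda>s. point (\<gamma> s))"
        by (rule continuous_on_compose2[OF point_cont \<gamma>(1) subset_UNIV])
      show "t \<in> {0<..<e C}" using t t_less[OF C(1)] by simp
    next
      fix s assume "s \<in> {0<..<e C}"
      then have s: "\<gamma> s \<in> C" "\<gamma> s 0 = s" using \<gamma>(2) by blast+
      show "point (\<gamma> s) \<in> S" using CS[OF s(1)] .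
      show "dist (point (\<gamma> s)) a < s" using Cnear[OF s(1)] s(2) by simp
    qed (rule a)
    have "path_component S y (point (\<gamma> t))"
    proof -
      have "path_connected C" using cells C(1) by blast
      then have "path_connected (point ` C)" by (rule path_connected_continuous_image[OF point_cont])
      moreover have "\<gamma> t \<in> C" using \<gamma>(2)[of t] t t_less[OF C(1)] by simp
      ultimately have "path_component (point ` C) (point z) (point (\<gamma> t))"
        using C(2) unfolding path_connected_component by blast
      moreover have "point ` C \<subseteq> S" using CS by blast
      ultimately have "path_component S (point z) (point (\<gamma> t))" by (rule path_component_of_subset[rotated])
      then show ?thesis using z(1) by simp
    qed
    from path_component_trans[OF y(1) path_component_trans[OF this to_a]]
    show "path_component S x a" .
  qed
qed

section \<open>Solution sets of vector optimization problems\<close>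

text \<open>In the space of pairs \<open>(x, y)\<close>, the condition that \<open>y \<in> K\<close> improves \<open>x\<close> is determined by signs of
  polynomials; projecting away \<open>y\<close> leaves the points that can be improved.\<close>

lemma semialgebraic_unimprovable_points:
  fixes K :: "(real ^ 'n) set" and f :: "real ^ 'n \<Rightarrow> real ^ 'm"
  assumes K: "semialgebraic K"
    and f: "\<And>i. real_polynomial_function (\<lambda>x. f x $ i)"
    and D: "\<And>u w. (\<And>i. sgn (u $ i) = sgn (w $ i)) \<Longrightarrow> u \<in> D \<Longrightarrow> w \<in> D"
  shows "semialgebraic {x \<in> K. \<forall>y\<in>K. f y - f x \<notin> D}"
proof -
  define N where "N = CARD('n)"
  obtain h where "bij_betw h (UNIV :: 'n set) {0..<N}"
    unfolding N_def using ex_bij_betw_finite_nat[of "UNIV :: 'n set"] by auto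
  then have h_inj: "inj h" and "range h = {0..<N}" by (simp_all add: bij_betw_def)
  then have hN: "h i < N" for i by (metis atLeastLessThan_iff rangeI)
  define xpart ypart :: "(nat \<Rightarrow> real) \<Rightarrow> real ^ 'n"
    where "xpart z = (\<chi> i. z (h i))" and "ypart z = (\<chi> i. z (N + h i))" for z
  define e where "e v j = (if j < N then v $ inv h j else 0)" for v :: "real ^ 'n" and j
  have comp: "(\<lambda>z. p (xpart z)) \<in> coord_polys (N + N)" "(\<lambda>z. p (ypart z)) \<in> coord_polys (N + N)"
    if "real_polynomial_function p" for p
  proof -
    have "(\<lambda>z. z (h i)) \<in> coord_polys (N + N)" "(\<lambda>z. z (N + h i)) \<in> coord_polys (N + N)" for i
      using hN[of i] by (simp_all add: coord_polys.coord)
    then show "(\<lambda>z. p (xpart z)) \<in> coord_polys (N + N)" "(\<lambda>z. p (ypart z)) \<in> coord_polys (N + N)"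
      by (intro real_polynomial_function_compose_coord_polys[OF that]; simp add: xpart_def ypart_def)+
  qed
  define W where "W = ypart -` K \<inter> {z. f (ypart z) - f (xpart z) \<in> D}"
  have K': "sign_determined (Collect real_polynomial_function) K"
    using K by (simp add: semialgebraic_iff_sign_determined)
  have "sign_determined (coord_polys (N + N)) (ypart -` K)"
    using K' by (rule sign_determined_vimage) (simp add: comp)
  moreover have "sign_determined (coord_polys (N + N)) {z. f (ypart z) - f (xpart z) \<in> D}"
  proof -
    define Q where "Q = range (\<lambda>i z. f (ypart z) $ i - f (xpart z) $ i)"
    have "Q \<subseteq> coord_polys (N + N)"
      unfolding Q_def using comp[OF f] coord_polys.diff_mem by blast
    moreover have "f (ypart w) - f (xpart w) \<in> D" if "same_signs Q z w" "f (ypart z) - f (xpart z) \<in> D" for z w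
    proof (rule D[OF _ that(2)])
      fix i
      have "(\<lambda>z. f (ypart z) $ i - f (xpart z) $ i) \<in> Q" unfolding Q_def by (rule rangeI)
      from bspec[OF that(1)[unfolded same_signs_def] this]
      show "sgn ((f (ypart z) - f (xpart z)) $ i) = sgn ((f (ypart w) - f (xpart w)) $ i)" by simp
    qed
    then have "f (ypart z) - f (xpart z) \<in> D \<longleftrightarrow> f (ypart w) - f (xpart w) \<in> D" if "same_signs Q z w" for z w
      using that same_signs_sym[OF that] by (intro iffI)
    moreover have "finite Q" by (simp add: Q_def)
    ultimately show ?thesis unfolding sign_determined_def mem_Collect_eq
      by (intro exI[of _ Q] conjI allI impI)
  qed
  ultimately have "sign_determined (coord_polys (N + N)) W"
    unfolding W_def by (rule sign_determined_Int)
  define X where "X = {x. \<exists>z. (\<forall>i<N. z i = x i) \<and> z \<in> W}"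
  have "sign_determined (coord_polys N) X"
    unfolding X_def by (rule sign_determined_iterated_projection) fact
  then have "sign_determined (Collect real_polynomial_function) (e -` X)"
  proof (rule sign_determined_vimage)
    fix q assume "q \<in> coord_polys N"
    then show "(\<lambda>v. q (e v)) \<in> Collect real_polynomial_function"
      unfolding mem_Collect_eq
    proof (rule coord_polys_compose_real_polynomial_function)
      fix j assume "j < N"
      then show "real_polynomial_function (\<lambda>v. e v j)"
        by (simp add: e_def real_polynomial_function.intros bounded_linear_vec_nth)
    qed
  qed
  then have "sign_determined (Collect real_polynomial_function) (K \<inter> - (e -` X))"
    by (intro sign_determined_Int[OF K'] sign_determined_Compl)
  moreover have "e v \<in> X \<longleftrightarrow> (\<exists>y\<in>K. f y - f v \<in> D)" for v
  proof
    assume "e v \<in> X"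
    then obtain z where z: "\<And>i. i < N \<Longrightarrow> z i = e v i" "z \<in> W" unfolding X_def by blast
    have "z (h i) = v $ i" for i using z(1)[OF hN, of i] hN[of i] h_inj by (simp add: e_def)
    then have "xpart z = v" by (simp add: xpart_def vec_eq_iff)
    then have "ypart z \<in> K" "f (ypart z) - f v \<in> D" using z(2) by (simp_all add: W_def)
    then show "\<exists>y\<in>K. f y - f v \<in> D" by (rule bexI[rotated])
  next
    assume "\<exists>y\<in>K. f y - f v \<in> D"
    then obtain y where y: "y \<in> K" "f y - f v \<in> D" by blast
    define z where "z j = (if j < N then e v j else y $ inv h (j - N))" for j
    have "xpart z = v" using hN h_inj by (simp add: xpart_def z_def e_def vec_eq_iff)
    moreover have "ypart z = y" using h_inj by (simp add: ypart_def z_def vec_eq_iff)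
    ultimately have "z \<in> W" using y by (simp add: W_def)
    moreover have "\<forall>i<N. z i = e v i" by (simp add: z_def)
    ultimately show "e v \<in> X" unfolding X_def by blast
  qed
  then have "K \<inter> - (e -` X) = {x \<in> K. \<forall>y\<in>K. f y - f x \<notin> D}"
    by (simp add: set_eq_iff)
  ultimately show ?thesis by (simp add: semialgebraic_iff_sign_determined)
qed

lemma interior_nonneg_orthant:
  "interior (nonneg_orthant :: (real ^ 'm) set) = {v. \<forall>i. 0 < v $ i}"
proof
  have "open (\<Inter>i. {v :: real ^ 'm. 0 < v $ i})"
    by (intro open_INT ballI open_Collect_less continuous_intros) simp
  also have "(\<Inter>i. {v :: real ^ 'm. 0 < v $ i}) = {v. \<forall>i. 0 < v $ i}" by auto
  finally have "open {v :: real ^ 'm. \<forall>i. 0 < v $ i}" .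
  then show "{v :: real ^ 'm. \<forall>i. 0 < v $ i} \<subseteq> interior nonneg_orthant"
    by (intro interior_maximal) (auto simp: nonneg_orthant_def less_imp_le)
  show "interior (nonneg_orthant :: (real ^ 'm) set) \<subseteq> {v. \<forall>i. 0 < v $ i}"
  proof (intro subsetI CollectI allI)
    fix v :: "real ^ 'm" and i
    assume "v \<in> interior nonneg_orthant"
    then obtain r where r: "r > 0" "ball v r \<subseteq> nonneg_orthant" by (auto simp: mem_interior)
    have "v - (r / 2) *\<^sub>R axis i 1 \<in> ball v r" using r(1) by (simp add: dist_norm)
    then have "0 \<le> (v - (r / 2) *\<^sub>R axis i 1) $ i" using r(2) unfolding nonneg_orthant_def by blast
    then show "0 < v $ i" using r(1) by simp
  qed
qed

theorem theorem3p3: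
  fixes K :: "(real ^ 'n) set"
    and f :: "real ^ 'n \<Rightarrow> real ^ 'm"
  assumes "K \<noteq> {}"
    and "closed K"
    and "semialgebraic K"
    and "\<And>i. real_polynomial_function (\<lambda>x. f x $ i)"
  shows "semialgebraic (weak_pareto_solutions K f) \<and>
         semialgebraic (pareto_solutions K f) \<and>
         finite (components (weak_pareto_solutions K f)) \<and>
         (\<forall>C \<in> components (weak_pareto_solutions K f). path_connected C) \<and>
         finite (components (pareto_solutions K f)) \<and>
         (\<forall>C \<in> components (pareto_solutions K f). path_connected C)"
proof -
  have neg: "w \<in> uminus ` A \<longleftrightarrow> - w \<in> A" for w :: "real ^ 'm" and A
    by (auto intro: rev_image_eqI)
  have "semialgebraic (weak_pareto_solutions K f)"
    unfolding weak_pareto_solutions_def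
  proof (rule semialgebraic_unimprovable_points[OF assms(3,4)])
    fix u w :: "real ^ 'm"
    assume s: "\<And>i. sgn (u $ i) = sgn (w $ i)" and u: "u \<in> uminus ` interior nonneg_orthant"
    have "u $ i < 0" for i using u by (simp add: neg interior_nonneg_orthant)
    then have "w $ i < 0" for i using s by (metis sgn_less)
    then show "w \<in> uminus ` interior nonneg_orthant" by (simp add: neg interior_nonneg_orthant)
  qed
  moreover have "semialgebraic (pareto_solutions K f)"
    unfolding pareto_solutions_def
  proof (rule semialgebraic_unimprovable_points[OF assms(3,4)])
    fix u w :: "real ^ 'm"
    assume s: "\<And>i. sgn (u $ i) = sgn (w $ i)" and u: "u \<in> uminus ` nonneg_orthant - {0}"
    have "u $ i \<le> 0" for i using u by (simp add: neg nonneg_orthant_def)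
    then have "w $ i \<le> 0" for i using s by (metis sgn_greater not_le)
    moreover obtain i where "u $ i \<noteq> 0" using u by (auto simp: vec_eq_iff)
    then have "w $ i \<noteq> 0" using s by (metis sgn_eq_0_iff)
    ultimately show "w \<in> uminus ` nonneg_orthant - {0}"
      by (auto simp: neg nonneg_orthant_def vec_eq_iff)
  qed
  ultimately show ?thesis using semialgebraic_components by blast
qed

end
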